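(* Let $\mathcal H$ be a vector sublattice of $L^\Phi(\mathfrak P)$ that contains $\mathbf 1_\Omega$ and generates $\mathcal F$, and assume $L^\infty(\mathfrak P)\subset L^\Phi(\mathfrak P)$. The following statements are equivalent: (1) $\mathcal H$ is Dedekind $\sigma$-complete and $\mathfrak P\approx\mathbf{ca}_+^\sigma(\mathcal H)$. (2) $\mathcal H$ is Dedekind $\sigma$-complete and $\mathbf{ca}(\mathcal H)=\mathbf{ca}^\sigma(\mathcal H)\cap\mathcal H^*$. (3) $\mathcal H$ is an ideal in $L^\Phi(\mathfrak P)$. If $\mathcal H\subset L^\infty(\mathfrak P)$, (1)–(3) are furthermore equivalent to: (4) $\mathcal H=L^\infty(\mathfrak P)$.
   Context: $(\Omega,\mathcal F)$ is a measurable space, $\mathfrak P$ a nonempty set of probability measures on it. $L^0(\mathfrak P)$ is the space of equivalence classes $[f]$ of measurable $f\colon\Omega\to\mathbb R$ under $f\sim g\iff \mathbb P(f=g)=1$ for all $\mathbb P\in\mathfrak P$, with the order $X\preceq Y$ iff $\mathbb P(f\le g)=1$ for all $\mathbb P\in\mathfrak P$, $f\in X$, $g\in Y$; it is a vector lattice. $L^\infty(\mathfrak P)\subset L^0(\mathfrak P)$ is the space of classes of bounded random variables. An Orlicz function is a lower semicontinuous, nondecreasing, convex $\phi\colon[0,\infty)\to[0,\infty]$ with $\phi(0)=0$ such that there are $x_0,x_1>0$ with $\phi(x_0)<\infty$, $\phi(x_1)>0$. $\Phi=(\phi_{\mathbb P})_{\mathbb P\in\mathfrak P}$ is a family of Orlicz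 functions; for $X\in L^0(\mathfrak P)$, $\|X\|_{L^\Phi(\mathfrak P)}=\inf\{\lambda>0:\sup_{\mathbb P\in\mathfrak P}\mathbb E_{\mathbb P}[\phi_{\mathbb P}(\lambda^{-1}|X|)]\le1\}$, and $L^\Phi(\mathfrak P)=\{X: \|X\|_{L^\Phi(\mathfrak P)}<\infty\}$; this is a Banach lattice. Standing assumption: $L^\infty(\mathfrak P)\subset L^\Phi(\mathfrak P)$. $\mathcal H$ generates $\mathcal F$ if the $\sigma$-algebra generated by $\{f\colon\Omega\to\mathbb R\text{ measurable}: [f]\in\mathcal H\}$ equals $\mathcal F$. $\mathbf{ca}$: signed measures on $(\Omega,\mathcal F)$ of finite total variation; $\mathbf{ca}_+$: finite measures. For nonempty $\mathfrak Q,\mathfrak R\subset\mathbf{ca}$, $\mathfrak Q\ll\mathfrak R$ means $\sup_{\nu\in\mathfrak R}|\nu|(N)=0$ implies $\sup_{\mu\in\mathfrak Q}|\mu|(N)=0$ for $N\in\mathcal F$; $\mathfrak Q\approx\mathfrak R$ means $\mathfrak Q\ll\mathfrak R$ and $\mathfrak R\ll\mathfrak Q$. $\mathbf{ca}(\mathfrak P)=\{\mu\in\mathbf{ca}:\mu\ll\mathfrak P\}$. $\mathbf{ca}(\mathcal H)$ is the set of $\mu\in\mathbf{ca}(\mathfrak P)$ such that every $X\in\mathcal H$ is $|\mu|$-integrable and $X\mapsto\int X\,d|\mu|$ is norm continuous on $\mathcal H$. A functional $\ell\colon\mathcal X\to\mathbb R$ on a vector lattice is $\sigma$-order continuous if (i)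 $\{\ell(z): x\preceq z\preceq y\}$ is bounded for all $x,y\in\mathcal X$, and (ii) $\lim_n|\ell(x_n)|=0$ for all sequences $(x_n)\subset\mathcal X$ for which there is $(y_n)\subset\mathcal X_+$ with $|x_n|\preceq y_n$ for all $n$ and $y_n\downarrow0$ (i.e. $y_{n+1}\preceq y_n$ and $\inf_ny_n=0$ in $\mathcal X$). Every $\sigma$-order continuous linear functional on $\mathcal H$ is of the form $X\mapsto\int X\,d\mu$ for a unique $\mu\in\mathbf{ca}(\mathfrak P)$ for which all $X\in\mathcal H$ are $|\mu|$-integrable; $\mathbf{ca}^\sigma(\mathcal H)\subset\mathbf{ca}(\mathfrak P)$ is the set of these measures and $\mathbf{ca}^\sigma_+(\mathcal H)=\mathbf{ca}^\sigma(\mathcal H)\cap\mathbf{ca}_+$. $\mathcal H^*$ is the norm dual of $(\mathcal H,\|\cdot\|_{L^\Phi(\mathfrak P)})$; measures are identified with the functionals $X\mapsto\int X\,d\mu$. A vector lattice is Dedekind $\sigma$-complete if every countable subset with an upper bound has a least upper bound. An ideal $I$ in a vector lattice is a vector subspace such that $|X|\preceq|Y|$, $Y\in I$ imply $X\in I$. *)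

theory Defs
  imports "HOL-Probability.Probability"
begin

text \<open>Throughout, \<open>M\<close> only plays the role of the measurable space \<open>(space M, sets M)\<close>;
  its own measure is never used. \<open>PP\<close> is the set of probability measures on it.\<close>

section \<open>The space of equivalence classes of random variables\<close>

definition qs_eq :: "'a measure \<Rightarrow> 'a measure set \<Rightarrow> (('a \<Rightarrow> real) \<times> ('a \<Rightarrow> real)) set" where
  "qs_eq M PP = {(f, g). f \<in> borel_measurable M \<and> g \<in> borel_measurable M \<and>
      (\<forall>P\<in>PP. AE x in P. f x = g x)}"

definition L0 :: "'a measure \<Rightarrow> 'a measure set \<Rightarrow> ('a \<Rightarrow> real) set set" where
  "L0 M PP = borel_measurable M // qs_eq M PP"

definition L0_class :: "'a measure \<Rightarrow> 'a measure set \<Rightarrow> ('a \<Rightarrow> real) \<Rightarrow> ('a \<Rightarrow> real) set" where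
  "L0_class M PP f = qs_eq M PP `` {f}"

text \<open>An arbitrary representative. Everything defined through \<open>L0_rep\<close> below is independent of
  the choice, for measures that do not charge the common null sets of \<open>PP\<close>.\<close>

definition L0_rep :: "('a \<Rightarrow> real) set \<Rightarrow> 'a \<Rightarrow> real" where
  "L0_rep X = (SOME f. f \<in> X)"

definition L0_le :: "'a measure set \<Rightarrow> ('a \<Rightarrow> real) set \<Rightarrow> ('a \<Rightarrow> real) set \<Rightarrow> bool" where
  "L0_le PP X Y \<longleftrightarrow> (\<forall>P\<in>PP. \<forall>f\<in>X. \<forall>g\<in>Y. AE x in P. f x \<le> g x)"

definition L0_zero :: "'a measure \<Rightarrow> 'a measure set \<Rightarrow> ('a \<Rightarrow> real) set" where
  "L0_zero M PP = L0_class M PP (\<lambda>x. 0)"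

definition L0_one :: "'a measure \<Rightarrow> 'a measure set \<Rightarrow> ('a \<Rightarrow> real) set" where
  "L0_one M PP = L0_class M PP (indicator (space M))"

definition L0_add ::
    "'a measure \<Rightarrow> 'a measure set \<Rightarrow> ('a \<Rightarrow> real) set \<Rightarrow> ('a \<Rightarrow> real) set \<Rightarrow> ('a \<Rightarrow> real) set" where
  "L0_add M PP X Y = L0_class M PP (\<lambda>x. L0_rep X x + L0_rep Y x)"

definition L0_scale ::
    "'a measure \<Rightarrow> 'a measure set \<Rightarrow> real \<Rightarrow> ('a \<Rightarrow> real) set \<Rightarrow> ('a \<Rightarrow> real) set" where
  "L0_scale M PP c X = L0_class M PP (\<lambda>x. c * L0_rep X x)"

definition L0_diff ::
    "'a measure \<Rightarrow> 'a measure set \<Rightarrow> ('a \<Rightarrow> real) set \<Rightarrow> ('a \<Rightarrow> real) set \<Rightarrow> ('a \<Rightarrow> real) set" where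
  "L0_diff M PP X Y = L0_class M PP (\<lambda>x. L0_rep X x - L0_rep Y x)"

definition L0_sup ::
    "'a measure \<Rightarrow> 'a measure set \<Rightarrow> ('a \<Rightarrow> real) set \<Rightarrow> ('a \<Rightarrow> real) set \<Rightarrow> ('a \<Rightarrow> real) set" where
  "L0_sup M PP X Y = L0_class M PP (\<lambda>x. max (L0_rep X x) (L0_rep Y x))"

definition L0_inf ::
    "'a measure \<Rightarrow> 'a measure set \<Rightarrow> ('a \<Rightarrow> real) set \<Rightarrow> ('a \<Rightarrow> real) set \<Rightarrow> ('a \<Rightarrow> real) set" where
  "L0_inf M PP X Y = L0_class M PP (\<lambda>x. min (L0_rep X x) (L0_rep Y x))"

definition L0_abs ::
    "'a measure \<Rightarrow> 'a measure set \<Rightarrow> ('a \<Rightarrow> real) set \<Rightarrow> ('a \<Rightarrow> real) set" where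
  "L0_abs M PP X = L0_class M PP (\<lambda>x. \<bar>L0_rep X x\<bar>)"

definition Linf :: "'a measure \<Rightarrow> 'a measure set \<Rightarrow> ('a \<Rightarrow> real) set set" where
  "Linf M PP = {L0_class M PP f | f. f \<in> borel_measurable M \<and> bounded (f ` space M)}"

definition L0_subspace :: "'a measure \<Rightarrow> 'a measure set \<Rightarrow> ('a \<Rightarrow> real) set set \<Rightarrow> bool" where
  "L0_subspace M PP V \<longleftrightarrow> V \<subseteq> L0 M PP \<and> L0_zero M PP \<in> V \<and>
     (\<forall>X\<in>V. \<forall>Y\<in>V. L0_add M PP X Y \<in> V) \<and> (\<forall>c. \<forall>X\<in>V. L0_scale M PP c X \<in> V)"

definition vector_sublattice_of ::
    "'a measure \<Rightarrow> 'a measure set \<Rightarrow> ('a \<Rightarrow> real) set set \<Rightarrow> ('a \<Rightarrow> real) set set \<Rightarrow> bool" where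
  "vector_sublattice_of M PP E H \<longleftrightarrow> H \<subseteq> E \<and> L0_subspace M PP H \<and>
     (\<forall>X\<in>H. \<forall>Y\<in>H. L0_sup M PP X Y \<in> H \<and> L0_inf M PP X Y \<in> H)"

definition ideal_in ::
    "'a measure \<Rightarrow> 'a measure set \<Rightarrow> ('a \<Rightarrow> real) set set \<Rightarrow> ('a \<Rightarrow> real) set set \<Rightarrow> bool" where
  "ideal_in M PP E I \<longleftrightarrow> I \<subseteq> E \<and> L0_subspace M PP I \<and>
     (\<forall>X\<in>E. \<forall>Y\<in>I. L0_le PP (L0_abs M PP X) (L0_abs M PP Y) \<longrightarrow> X \<in> I)"

definition generates :: "'a measure \<Rightarrow> 'a measure set \<Rightarrow> ('a \<Rightarrow> real) set set \<Rightarrow> bool" where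
  "generates M PP H \<longleftrightarrow>
     sigma_sets (space M) {f -` B \<inter> space M | f B.
        f \<in> borel_measurable M \<and> L0_class M PP f \<in> H \<and> B \<in> sets borel} = sets M"

section \<open>Orlicz functions and the robust Orlicz space\<close>

text \<open>An Orlicz function has domain \<open>[0,\<infinity>)\<close>; its values at negative arguments are junk.\<close>

definition orlicz_function :: "(real \<Rightarrow> ennreal) \<Rightarrow> bool" where
  "orlicz_function \<phi> \<longleftrightarrow>
     (\<forall>x\<ge>0. \<phi> x \<le> Liminf (at x within {0..}) \<phi>) \<and>
     mono_on {0..} \<phi> \<and>
     (\<forall>x\<ge>0. \<forall>y\<ge>0. \<forall>t\<in>{0..1}.
        \<phi> ((1 - t) * x + t * y) \<le> ennreal (1 - t) * \<phi> x + ennreal t * \<phi> y) \<and>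
     \<phi> 0 = 0 \<and> (\<exists>x>0. \<phi> x < \<infinity>) \<and> (\<exists>x>0. \<phi> x > 0)"

definition orlicz_norm ::
    "'a measure set \<Rightarrow> ('a measure \<Rightarrow> real \<Rightarrow> ennreal) \<Rightarrow> ('a \<Rightarrow> real) set \<Rightarrow> ennreal" where
  "orlicz_norm PP \<Phi> X =
     Inf (ennreal ` {l. l > 0 \<and> (SUP P\<in>PP. \<integral>\<^sup>+x. \<Phi> P (inverse l * \<bar>L0_rep X x\<bar>) \<partial>P) \<le> 1})"

definition orlicz_space ::
    "'a measure \<Rightarrow> 'a measure set \<Rightarrow> ('a measure \<Rightarrow> real \<Rightarrow> ennreal) \<Rightarrow> ('a \<Rightarrow> real) set set" where
  "orlicz_space M PP \<Phi> = {X \<in> L0 M PP. orlicz_norm PP \<Phi> X < \<infinity>}"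

section \<open>Signed measures\<close>

text \<open>Signed measures are real-valued set functions, extended by 0 outside the \<open>\<sigma>\<close>-algebra so
  that equality of measures is equality of functions; this matches the convention for
  \<^const>\<open>measure\<close>, so \<open>measure P\<close> is the signed measure given by a finite measure \<open>P\<close>.\<close>

definition tv :: "'a measure \<Rightarrow> ('a set \<Rightarrow> real) \<Rightarrow> 'a measure" where
  "tv M \<mu> = measure_of (space M) (sets M)
     (\<lambda>A. SUP D\<in>{D. finite D \<and> D \<subseteq> sets M \<and> partition_on A D}. \<Sum>B\<in>D. ennreal \<bar>\<mu> B\<bar>)"

definition ca :: "'a measure \<Rightarrow> ('a set \<Rightarrow> real) set" where
  "ca M = {\<mu>. (\<forall>A. A \<notin> sets M \<longrightarrow> \<mu> A = 0) \<and> \<mu> {} = 0 \<and>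
     (\<forall>A :: nat \<Rightarrow> 'a set. range A \<subseteq> sets M \<longrightarrow> disjoint_family A \<longrightarrow>
        (\<lambda>i. \<mu> (A i)) sums \<mu> (\<Union>i. A i)) \<and>
     emeasure (tv M \<mu>) (space M) < \<infinity>}"

definition ca_plus :: "'a measure \<Rightarrow> ('a set \<Rightarrow> real) set" where
  "ca_plus M = {\<mu> \<in> ca M. \<forall>A\<in>sets M. 0 \<le> \<mu> A}"

text \<open>Jordan decomposition: \<open>\<mu>\<^sup>\<plusminus> = (|\<mu>| \<plusminus> \<mu>) / 2\<close>.\<close>

definition pos_part :: "'a measure \<Rightarrow> ('a set \<Rightarrow> real) \<Rightarrow> 'a measure" where
  "pos_part M \<mu> = measure_of (space M) (sets M) (\<lambda>A. ennreal ((measure (tv M \<mu>) A + \<mu> A) / 2))"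

definition neg_part :: "'a measure \<Rightarrow> ('a set \<Rightarrow> real) \<Rightarrow> 'a measure" where
  "neg_part M \<mu> = measure_of (space M) (sets M) (\<lambda>A. ennreal ((measure (tv M \<mu>) A - \<mu> A) / 2))"

definition sint :: "'a measure \<Rightarrow> ('a set \<Rightarrow> real) \<Rightarrow> ('a \<Rightarrow> real) set \<Rightarrow> real" where
  "sint M \<mu> X = (\<integral>x. L0_rep X x \<partial>pos_part M \<mu>) - (\<integral>x. L0_rep X x \<partial>neg_part M \<mu>)"

definition dominated :: "'a measure \<Rightarrow> ('a set \<Rightarrow> real) set \<Rightarrow> ('a set \<Rightarrow> real) set \<Rightarrow> bool" where
  "dominated M Q R \<longleftrightarrow> (\<forall>N\<in>sets M.
     (SUP \<nu>\<in>R. emeasure (tv M \<nu>) N) = 0 \<longrightarrow> (SUP \<mu>\<in>Q. emeasure (tv M \<mu>) N) = 0)"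

definition equivalent :: "'a measure \<Rightarrow> ('a set \<Rightarrow> real) set \<Rightarrow> ('a set \<Rightarrow> real) set \<Rightarrow> bool" where
  "equivalent M Q R \<longleftrightarrow> dominated M Q R \<and> dominated M R Q"

definition ca_of :: "'a measure \<Rightarrow> 'a measure set \<Rightarrow> ('a set \<Rightarrow> real) set" where
  "ca_of M PP = {\<mu> \<in> ca M. dominated M {\<mu>} (measure ` PP)}"

section \<open>Order and norm properties; the dual spaces of measures\<close>

definition is_lub_in :: "('b \<Rightarrow> 'b \<Rightarrow> bool) \<Rightarrow> 'b set \<Rightarrow> 'b set \<Rightarrow> 'b \<Rightarrow> bool" where
  "is_lub_in le H C s \<longleftrightarrow>
     s \<in> H \<and> (\<forall>c\<in>C. le c s) \<and> (\<forall>u\<in>H. (\<forall>c\<in>C. le c u) \<longrightarrow> le s u)"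

definition is_glb_in :: "('b \<Rightarrow> 'b \<Rightarrow> bool) \<Rightarrow> 'b set \<Rightarrow> 'b set \<Rightarrow> 'b \<Rightarrow> bool" where
  "is_glb_in le H C s \<longleftrightarrow>
     s \<in> H \<and> (\<forall>c\<in>C. le s c) \<and> (\<forall>u\<in>H. (\<forall>c\<in>C. le u c) \<longrightarrow> le u s)"

text \<open>The empty set must be excluded: in a nonzero vector lattice it has no least upper bound.\<close>

definition dedekind_sigma_complete :: "('b \<Rightarrow> 'b \<Rightarrow> bool) \<Rightarrow> 'b set \<Rightarrow> bool" where
  "dedekind_sigma_complete le H \<longleftrightarrow> (\<forall>C. C \<subseteq> H \<longrightarrow> C \<noteq> {} \<longrightarrow> countable C \<longrightarrow>
     (\<exists>u\<in>H. \<forall>c\<in>C. le c u) \<longrightarrow> (\<exists>s. is_lub_in le H C s))"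

definition linear_functional_on ::
    "'a measure \<Rightarrow> 'a measure set \<Rightarrow> ('a \<Rightarrow> real) set set \<Rightarrow> (('a \<Rightarrow> real) set \<Rightarrow> real) \<Rightarrow> bool" where
  "linear_functional_on M PP H l \<longleftrightarrow>
     (\<forall>X\<in>H. \<forall>Y\<in>H. l (L0_add M PP X Y) = l X + l Y) \<and>
     (\<forall>c. \<forall>X\<in>H. l (L0_scale M PP c X) = c * l X)"

text \<open>The infimum of \<open>(y\<^sub>n)\<close> is taken in the lattice \<open>H\<close> itself, not in the ambient space.\<close>

definition sigma_order_continuous ::
    "'a measure \<Rightarrow> 'a measure set \<Rightarrow> ('a \<Rightarrow> real) set set \<Rightarrow> (('a \<Rightarrow> real) set \<Rightarrow> real) \<Rightarrow> bool" where
  "sigma_order_continuous M PP H l \<longleftrightarrow>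
     (\<forall>X\<in>H. \<forall>Y\<in>H. bounded {l Z | Z. Z \<in> H \<and> L0_le PP X Z \<and> L0_le PP Z Y}) \<and>
     (\<forall>xs :: nat \<Rightarrow> ('a \<Rightarrow> real) set.
        (\<forall>n. xs n \<in> H) \<longrightarrow>
        (\<exists>ys :: nat \<Rightarrow> ('a \<Rightarrow> real) set.
           (\<forall>n. ys n \<in> H \<and> L0_le PP (L0_zero M PP) (ys n)) \<and>
           (\<forall>n. L0_le PP (L0_abs M PP (xs n)) (ys n)) \<and>
           (\<forall>n. L0_le PP (ys (Suc n)) (ys n)) \<and>
           is_glb_in (L0_le PP) H (range ys) (L0_zero M PP)) \<longrightarrow>
        (\<lambda>n. \<bar>l (xs n)\<bar>) \<longlonglongrightarrow> 0)"

definition norm_continuous_on ::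
    "'a measure \<Rightarrow> 'a measure set \<Rightarrow> ('a measure \<Rightarrow> real \<Rightarrow> ennreal) \<Rightarrow> ('a \<Rightarrow> real) set set \<Rightarrow>
     (('a \<Rightarrow> real) set \<Rightarrow> real) \<Rightarrow> bool" where
  "norm_continuous_on M PP \<Phi> H l \<longleftrightarrow>
     (\<forall>X\<in>H. \<forall>e>0. \<exists>d>0. \<forall>Y\<in>H.
        orlicz_norm PP \<Phi> (L0_diff M PP Y X) < ennreal d \<longrightarrow> \<bar>l Y - l X\<bar> < e)"

definition norm_dual ::
    "'a measure \<Rightarrow> 'a measure set \<Rightarrow> ('a measure \<Rightarrow> real \<Rightarrow> ennreal) \<Rightarrow> ('a \<Rightarrow> real) set set \<Rightarrow>
     (('a \<Rightarrow> real) set \<Rightarrow> real) set" where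
  "norm_dual M PP \<Phi> H = {l. linear_functional_on M PP H l \<and> norm_continuous_on M PP \<Phi> H l}"

definition ca_H ::
    "'a measure \<Rightarrow> 'a measure set \<Rightarrow> ('a measure \<Rightarrow> real \<Rightarrow> ennreal) \<Rightarrow> ('a \<Rightarrow> real) set set \<Rightarrow>
     ('a set \<Rightarrow> real) set" where
  "ca_H M PP \<Phi> H = {\<mu> \<in> ca_of M PP. (\<forall>X\<in>H. integrable (tv M \<mu>) (L0_rep X)) \<and>
     norm_continuous_on M PP \<Phi> H (\<lambda>X. \<integral>x. L0_rep X x \<partial>tv M \<mu>)}"

definition ca_sigma ::
    "'a measure \<Rightarrow> 'a measure set \<Rightarrow> ('a \<Rightarrow> real) set set \<Rightarrow> ('a set \<Rightarrow> real) set" where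
  "ca_sigma M PP H = {\<mu> \<in> ca_of M PP. (\<forall>X\<in>H. integrable (tv M \<mu>) (L0_rep X)) \<and>
     linear_functional_on M PP H (sint M \<mu>) \<and> sigma_order_continuous M PP H (sint M \<mu>)}"

definition ca_sigma_plus ::
    "'a measure \<Rightarrow> 'a measure set \<Rightarrow> ('a \<Rightarrow> real) set set \<Rightarrow> ('a set \<Rightarrow> real) set" where
  "ca_sigma_plus M PP H = ca_sigma M PP H \<inter> ca_plus M"

end

theory Submission
  imports Defs
begin

text \<open>An ideal containing \<open>\<one>\<close> is closed under bounded pointwise suprema, so \<open>\<sigma>\<close>-order
  continuity of integrals on it is dominated convergence, and multiplication by the sign of a
  Hahn decomposition turns \<open>\<mu>\<close> into \<open>|\<mu>|\<close> without leaving the ideal or changing norms; this gives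
  (3) \<open>\<Longrightarrow>\<close> (2). Every \<open>P \<in> PP\<close> lies in \<open>ca_H\<close>, since an Orlicz function has an affine minorant of
  positive slope; hence (2) \<open>\<Longrightarrow>\<close> (1). Under (1), if \<open>x\<^sub>n\<close> increases to a supremum \<open>\<sigma>\<close> in \<open>H\<close>, then
  \<open>\<integral> (\<sigma> - x\<^sub>n) d\<mu> \<rightarrow> 0\<close> for all \<open>\<mu>\<close> in a family equivalent to \<open>PP\<close>, so suprema of sequences in \<open>H\<close> are
  pointwise. Therefore \<open>{A. 1\<^sub>A \<in> H}\<close> is a \<open>\<sigma>\<close>-algebra containing all \<open>{f > c}\<close> with \<open>f \<in> H\<close>, hence
  all of \<open>M\<close>, and approximation by simple functions shows that \<open>H\<close> is an ideal.\<close>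

section \<open>Total variation and Hahn decomposition\<close>

text \<open>No single measure need dominate \<open>PP\<close>, so almost-sure statements become
  quasi-sure ones, which survive only countable conjunctions. The obstacle that shapes the proof is
  that bounds are formed in \<open>H\<close>: the supremum in \<open>H\<close> of an increasing
  sequence may exceed its pointwise limit, simply because \<open>H\<close> need not contain that
  limit. An ideal has no such gap, since there the pointwise bound represents an element of
  \<open>H\<close> and competes with the bound in \<open>H\<close>. Without solidity only
  functionals can detect the gap. That they do rests on translation invariance: the distances from a
  sequence to its supremum in \<open>H\<close> have infimum 0 in \<open>H\<close>, whatever happens
  pointwise, and this is exactly the input that sigma-order continuity accepts. A second difficulty
  is that \<open>ca_H\<close> speaks of |mu| and \<open>ca_sigma\<close> of mu. Comparing them
  requires a Hahn set for a signed measure given as a bare set function, and hence first a proof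
  that \<open>tv\<close> really is a measure with the intended values.\<close>

definition total_var :: "'a measure \<Rightarrow> ('a set \<Rightarrow> real) \<Rightarrow> 'a set \<Rightarrow> ennreal" where
  "total_var M \<mu> A =
     (SUP D\<in>{D. finite D \<and> D \<subseteq> sets M \<and> partition_on A D}. \<Sum>B\<in>D. ennreal \<bar>\<mu> B\<bar>)"

section \<open>Additivity of signed measures and of their total variation\<close>

lemma ca_empty: "\<mu> \<in> ca M \<Longrightarrow> \<mu> {} = 0"
  by (simp add: ca_def)

lemma ca_sums:
  fixes A :: "nat \<Rightarrow> 'a set"
  assumes "\<mu> \<in> ca M" "range A \<subseteq> sets M" "disjoint_family A"
  shows "(\<lambda>i. \<mu> (A i)) sums \<mu> (\<Union>i. A i)"
  using assms by (simp add: ca_def)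

lemma ca_Un:
  assumes "\<mu> \<in> ca M" "A \<in> sets M" "B \<in> sets M" "A \<inter> B = {}"
  shows "\<mu> (A \<union> B) = \<mu> A + \<mu> B"
proof -
  have "(\<lambda>i. \<mu> (binaryset A B i)) sums \<mu> (\<Union>i. binaryset A B i)"
    using assms by (intro ca_sums[OF assms(1)])
      (auto simp: range_binaryset_eq disjoint_family_on_def binaryset_def split: if_splits)
  moreover have "(\<lambda>i. \<mu> (binaryset A B i)) sums (\<mu> A + \<mu> B)"
    by (rule binaryset_sums) (rule ca_empty[OF assms(1)])
  ultimately show ?thesis
    by (simp add: UN_binaryset_eq sums_unique2)
qed

lemma ca_Union:
  assumes "\<mu> \<in> ca M" "finite D" "D \<subseteq> sets M" "disjoint D"
  shows "\<mu> (\<Union>D) = (\<Sum>B\<in>D. \<mu> B)"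
  using assms(2-4)
proof (induction D)
  case empty
  then show ?case by (simp add: ca_empty[OF assms(1)])
next
  case (insert B D)
  have "B \<inter> \<Union>D = {}"
    using insert.hyps(2) insert.prems(2) by (fastforce simp: disjoint_def)
  then have "\<mu> (B \<union> \<Union>D) = \<mu> B + \<mu> (\<Union>D)"
    using insert by (intro ca_Un[OF assms(1)]) auto
  moreover have "disjoint D"
    using insert.prems by (auto simp: disjoint_def)
  ultimately show ?case using insert by simp
qed

text \<open>Blocks of \<open>partition_on\<close> are nonempty, while a disjoint family may repeat
  the empty set. Empty members are dropped first: they contribute \<open>\<mu> {} = 0\<close>, and
  on the remaining indices the family is injective.\<close>

lemma sum_le_total_var:
  assumes "\<mu> {} = 0" "finite I" "\<And>i. i \<in> I \<Longrightarrow> B i \<in> sets M" "disjoint_family_on B I"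
    "(\<Union>i\<in>I. B i) = A"
  shows "(\<Sum>i\<in>I. ennreal \<bar>\<mu> (B i)\<bar>) \<le> total_var M \<mu> A"
proof -
  define J where "J = {i\<in>I. B i \<noteq> {}}"
  have inj: "inj_on B J"
    using assms(4) by (auto simp: inj_on_def J_def disjoint_family_on_def)
  have "(\<Sum>i\<in>I. ennreal \<bar>\<mu> (B i)\<bar>) = (\<Sum>i\<in>J. ennreal \<bar>\<mu> (B i)\<bar>)"
    using assms(1,2) by (intro sum.mono_neutral_right) (auto simp: J_def)
  also have "\<dots> = (\<Sum>C\<in>B ` J. ennreal \<bar>\<mu> C\<bar>)"
    using inj by (simp add: sum.reindex)
  also have "\<dots> \<le> total_var M \<mu> A"
    unfolding total_var_def
  proof (rule SUP_upper, safe)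
    show "finite (B ` J)" using assms(2) by (simp add: J_def)
    show "partition_on A (B ` J)"
      using assms(4,5) by (intro partition_onI)
        (auto simp: disjnt_def disjoint_family_on_def J_def dest: bspec)
  qed (use assms(3) in \<open>auto simp: J_def\<close>)
  finally show ?thesis .
qed

text \<open>Partitions of two disjoint sets combine to a partition of the union, and they share no
  block because blocks are nonempty. The reverse inequality is contained in the countable version
  below.\<close>

lemma total_var_superadditive:
  assumes "A \<in> sets M" "B \<in> sets M" "A \<inter> B = {}"
  shows "total_var M \<mu> A + total_var M \<mu> B \<le> total_var M \<mu> (A \<union> B)"
proof -
  let ?P = "\<lambda>A. {D. finite D \<and> D \<subseteq> sets M \<and> partition_on A D}"
  have ne: "?P C \<noteq> {}" if "C \<in> sets M" for C
  proof -
    have "{C} - {{}} \<in> ?P C" using that by (auto simp: partition_on_def disjoint_def)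
    then show ?thesis by blast
  qed
  have *: "(\<Sum>C\<in>D. ennreal \<bar>\<mu> C\<bar>) + (\<Sum>C\<in>E. ennreal \<bar>\<mu> C\<bar>) \<le> total_var M \<mu> (A \<union> B)"
    if "D \<in> ?P A" "E \<in> ?P B" for D E
  proof -
    have "D \<inter> E = {}"
    proof (rule ccontr)
      assume "D \<inter> E \<noteq> {}"
      then obtain C where C: "C \<in> D" "C \<in> E" by blast
      then have "C \<subseteq> A" "C \<subseteq> B" "C \<noteq> {}" using that by (auto simp: partition_on_def)
      then show False using assms(3) by blast
    qed
    then have "(\<Sum>C\<in>D. ennreal \<bar>\<mu> C\<bar>) + (\<Sum>C\<in>E. ennreal \<bar>\<mu> C\<bar>) = (\<Sum>C\<in>D \<union> E. ennreal \<bar>\<mu> C\<bar>)"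
      using that by (simp add: sum.union_disjoint)
    also have "D \<union> E \<in> ?P (A \<union> B)"
      using that assms(3) by (auto simp: partition_on_def intro!: disjoint_union)
    then have "(\<Sum>C\<in>D \<union> E. ennreal \<bar>\<mu> C\<bar>) \<le> total_var M \<mu> (A \<union> B)"
      unfolding total_var_def by (rule SUP_upper)
    finally show ?thesis .
  qed
  show ?thesis
    unfolding total_var_def[of M \<mu> A] total_var_def[of M \<mu> B] ennreal_SUP_add_left[OF ne[OF assms(1)], symmetric]
      ennreal_SUP_add_right[OF ne[OF assms(2)]]
    by (intro SUP_least *)
qed

lemma total_var_mono:
  assumes "A \<in> sets M" "B \<in> sets M" "A \<subseteq> B"
  shows "total_var M \<mu> A \<le> total_var M \<mu> B"
proof -
  have "total_var M \<mu> A + 0 \<le> total_var M \<mu> A + total_var M \<mu> (B - A)"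
    by (intro add_left_mono) simp
  also have "\<dots> \<le> total_var M \<mu> (A \<union> (B - A))"
    using assms by (intro total_var_superadditive) auto
  also have "A \<union> (B - A) = B" using assms by auto
  finally show ?thesis by simp
qed

lemma abs_sums_le_suminf:
  fixes f :: "nat \<Rightarrow> real"
  assumes "f sums s"
  shows "ennreal \<bar>s\<bar> \<le> (\<Sum>i. ennreal \<bar>f i\<bar>)"
proof (rule LIMSEQ_le_const2)
  show "(\<lambda>n. ennreal \<bar>\<Sum>i<n. f i\<bar>) \<longlonglongrightarrow> ennreal \<bar>s\<bar>"
    using assms by (auto simp: sums_def intro!: tendsto_intros)
  have "ennreal \<bar>\<Sum>i<n. f i\<bar> \<le> (\<Sum>i. ennreal \<bar>f i\<bar>)" for n
  proof -
    have "ennreal \<bar>\<Sum>i<n. f i\<bar> \<le> ennreal (\<Sum>i<n. \<bar>f i\<bar>)"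
      by (intro ennreal_leI sum_abs)
    also have "\<dots> = (\<Sum>i<n. ennreal \<bar>f i\<bar>)" by (simp add: sum_ennreal)
    also have "\<dots> \<le> (\<Sum>i. ennreal \<bar>f i\<bar>)" by (rule sum_le_suminf) auto
    finally show ?thesis .
  qed
  then show "\<exists>N. \<forall>n\<ge>N. ennreal \<bar>\<Sum>i<n. f i\<bar> \<le> (\<Sum>i. ennreal \<bar>f i\<bar>)" by blast
qed

text \<open>One inequality is superadditivity along partial sums. For the other, a finite partition
  of the union is cut along the sets \<open>A i\<close>: each block obeys a countable triangle
  inequality, and the pieces of all blocks inside one \<open>A i\<close> partition it.\<close>

lemma countably_additive_total_var:
  assumes "\<mu> \<in> ca M"
  shows "countably_additive (sets M) (total_var M \<mu>)"
proof (rule countably_additiveI)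
  fix A :: "nat \<Rightarrow> 'a set"
  assume A: "range A \<subseteq> sets M" "disjoint_family A" "(\<Union>i. A i) \<in> sets M"
  note mu0 = ca_empty[OF assms]
  show "(\<Sum>i. total_var M \<mu> (A i)) = total_var M \<mu> (\<Union>i. A i)"
  proof (rule antisym)
    have fin: "(\<Sum>i<n. total_var M \<mu> (A i)) \<le> total_var M \<mu> (\<Union>i<n. A i)" for n
    proof (induction n)
      case (Suc n)
      have "(\<Sum>i<Suc n. total_var M \<mu> (A i)) \<le> total_var M \<mu> (\<Union>i<n. A i) + total_var M \<mu> (A n)"
        using Suc by (simp add: add_mono)
      also have "\<dots> \<le> total_var M \<mu> ((\<Union>i<n. A i) \<union> A n)"
      proof (rule total_var_superadditive)
        have "A i \<inter> A n = {}" if "i < n" for i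
          using A(2) that by (auto simp: disjoint_family_on_def)
        then show "(\<Union>i<n. A i) \<inter> A n = {}" by blast
      qed (use A(1) in auto)
      also have "(\<Union>i<n. A i) \<union> A n = (\<Union>i<Suc n. A i)" by (auto simp: lessThan_Suc)
      finally show ?case .
    qed simp
    show "(\<Sum>i. total_var M \<mu> (A i)) \<le> total_var M \<mu> (\<Union>i. A i)"
    proof (rule suminf_le_const)
      fix n
      show "(\<Sum>i<n. total_var M \<mu> (A i)) \<le> total_var M \<mu> (\<Union>i. A i)"
        using A by (intro order_trans[OF fin] total_var_mono) auto
    qed simp
  next
    show "total_var M \<mu> (\<Union>i. A i) \<le> (\<Sum>i. total_var M \<mu> (A i))"
      unfolding total_var_def[of M \<mu> "\<Union>i. A i"]
    proof (rule SUP_least)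
      fix D assume "D \<in> {D. finite D \<and> D \<subseteq> sets M \<and> partition_on (\<Union>i. A i) D}"
      then have D: "finite D" "D \<subseteq> sets M" "\<Union>D = (\<Union>i. A i)" "disjoint D"
        by (auto simp: partition_on_def)
      have "ennreal \<bar>\<mu> B\<bar> \<le> (\<Sum>i. ennreal \<bar>\<mu> (B \<inter> A i)\<bar>)" if "B \<in> D" for B
      proof -
        have "(\<lambda>i. \<mu> (B \<inter> A i)) sums \<mu> (\<Union>i. B \<inter> A i)"
          using A D that by (intro ca_sums[OF assms]) (auto simp: disjoint_family_on_def)
        also have "(\<Union>i. B \<inter> A i) = B" using D that by blast
        finally show ?thesis by (rule abs_sums_le_suminf)
      qed
      then have "(\<Sum>B\<in>D. ennreal \<bar>\<mu> B\<bar>) \<le> (\<Sum>B\<in>D. \<Sum>i. ennreal \<bar>\<mu> (B \<inter> A i)\<bar>)"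
        by (rule sum_mono)
      also have "\<dots> = (\<Sum>i. \<Sum>B\<in>D. ennreal \<bar>\<mu> (B \<inter> A i)\<bar>)"
        by (rule suminf_sum[symmetric]) simp
      also have "\<dots> \<le> (\<Sum>i. total_var M \<mu> (A i))"
      proof (intro suminf_le sum_le_total_var mu0)
        fix i
        show "disjoint_family_on (\<lambda>B. B \<inter> A i) D"
          using D(4) by (auto simp: disjoint_family_on_def disjoint_def)
        show "(\<Union>B\<in>D. B \<inter> A i) = A i" using D(3) by blast
      qed (use A D in auto)
      finally show "(\<Sum>B\<in>D. ennreal \<bar>\<mu> B\<bar>) \<le> (\<Sum>i. total_var M \<mu> (A i))" .
    qed
  qed
qed

lemma total_var_empty:
  assumes "\<mu> {} = 0"
  shows "total_var M \<mu> {} = 0"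
proof -
  have "(\<Sum>B\<in>D. ennreal \<bar>\<mu> B\<bar>) = 0" if "partition_on {} D" for D
    using that assms by (auto simp: partition_on_def intro!: sum.neutral)
  then show ?thesis by (auto simp: total_var_def intro!: antisym SUP_least)
qed

text \<open>Without cancellation every partition sum equals \<open>\<mu> A\<close>. This serves both
  halves of a Hahn decomposition, with -mu in place of mu on the negative half.\<close>

lemma total_var_nonneg:
  assumes "\<mu> \<in> ca M" "A \<in> sets M" "\<And>B. B \<in> sets M \<Longrightarrow> B \<subseteq> A \<Longrightarrow> 0 \<le> \<mu> B"
  shows "total_var M \<mu> A = ennreal (\<mu> A)"
proof (rule antisym)
  show "total_var M \<mu> A \<le> ennreal (\<mu> A)"
    unfolding total_var_def
  proof (rule SUP_least)
    fix D assume "D \<in> {D. finite D \<and> D \<subseteq> sets M \<and> partition_on A D}"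
    then have D: "finite D" "D \<subseteq> sets M" "\<Union>D = A" "disjoint D"
      by (auto simp: partition_on_def)
    then have nn: "0 \<le> \<mu> B" if "B \<in> D" for B using that assms(3)[of B] by blast
    then have "(\<Sum>B\<in>D. ennreal \<bar>\<mu> B\<bar>) = ennreal (\<Sum>B\<in>D. \<mu> B)" by (simp add: sum_ennreal)
    also have "(\<Sum>B\<in>D. \<mu> B) = \<mu> A" using ca_Union[OF assms(1) D(1,2,4)] D(3) by simp
    finally show "(\<Sum>B\<in>D. ennreal \<bar>\<mu> B\<bar>) \<le> ennreal (\<mu> A)" by simp
  qed
  show "ennreal (\<mu> A) \<le> total_var M \<mu> A"
    using sum_le_total_var[of \<mu> "{()}" "\<lambda>_. A" M A] ca_empty[OF assms(1)] assms(2) assms(3)[of A]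
    by (simp add: disjoint_family_on_def)
qed

section \<open>The total variation as a measure, Jordan parts and Hahn sets\<close>

lemma sets_tv [simp, measurable_cong]: "sets (tv M \<mu>) = sets M"
  and space_tv [simp]: "space (tv M \<mu>) = space M"
  by (simp_all add: tv_def)

text \<open>\<open>measure_of\<close> yields the zero measure when its argument is not countably
  additive, so \<open>tv\<close> has the intended values only because of the preceding additivity
  result.\<close>

lemma emeasure_tv:
  assumes "\<mu> \<in> ca M" "A \<in> sets M"
  shows "emeasure (tv M \<mu>) A = total_var M \<mu> A"
  unfolding tv_def total_var_def[symmetric]
  by (rule emeasure_measure_of_sigma)
    (use assms countably_additive_total_var in \<open>auto simp: positive_def total_var_empty ca_empty sets.sigma_algebra_axioms\<close>)

lemma finite_measure_tv: "\<mu> \<in> ca M \<Longrightarrow> finite_measure (tv M \<mu>)"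
  by (rule finite_measureI) (simp add: ca_def less_top)

lemma abs_le_tv:
  assumes "\<mu> \<in> ca M" "A \<in> sets M"
  shows "\<bar>\<mu> A\<bar> \<le> measure (tv M \<mu>) A"
proof -
  interpret finite_measure "tv M \<mu>" by (rule finite_measure_tv[OF assms(1)])
  have "ennreal \<bar>\<mu> A\<bar> \<le> emeasure (tv M \<mu>) A"
    using sum_le_total_var[of \<mu> "{()}" "\<lambda>_. A" M A] ca_empty[OF assms(1)] assms
    by (simp add: disjoint_family_on_def emeasure_tv)
  then show ?thesis by (simp add: emeasure_eq_measure)
qed

text \<open>The sign \<open>c\<close> treats both Jordan parts at once. The bound |mu| \<le>
  \<open>tv\<close> keeps the set function nonnegative, so that \<open>ennreal\<close> does not
  truncate it.\<close>

lemma half_tv_measure: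
  assumes "\<mu> \<in> ca M" "\<bar>c\<bar> = 1"
  defines "N \<equiv> measure_of (space M) (sets M) (\<lambda>A. ennreal ((measure (tv M \<mu>) A + c * \<mu> A) / 2))"
  shows "sets N = sets M" "finite_measure N"
    "A \<in> sets M \<Longrightarrow> emeasure N A = ennreal ((measure (tv M \<mu>) A + c * \<mu> A) / 2)"
proof -
  interpret tv: finite_measure "tv M \<mu>" by (rule finite_measure_tv[OF assms(1)])
  let ?f = "\<lambda>A. (measure (tv M \<mu>) A + c * \<mu> A) / 2"
  have nn: "0 \<le> ?f A" if "A \<in> sets M" for A
    using abs_le_tv[OF assms(1) that] assms(2) by (auto simp: abs_if split: if_splits)
  have em: "emeasure N A = ennreal (?f A)" if "A \<in> sets M" for A
    unfolding N_def
  proof (rule emeasure_measure_of_sigma)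
    show "countably_additive (sets M) (\<lambda>A. ennreal (?f A))"
    proof (rule countably_additiveI)
      fix A :: "nat \<Rightarrow> 'a set"
      assume A: "range A \<subseteq> sets M" "disjoint_family A"
      have "(\<lambda>i. measure (tv M \<mu>) (A i)) sums measure (tv M \<mu>) (\<Union>i. A i)"
        using A by (intro tv.finite_measure_UNION) auto
      from sums_add[OF this sums_mult[OF ca_sums[OF assms(1) A], of c]]
      have "(\<lambda>i. ?f (A i)) sums ?f (\<Union>i. A i)" by (rule sums_divide)
      then show "(\<Sum>i. ennreal (?f (A i))) = ennreal (?f (\<Union>i. A i))"
        using nn A by (intro suminf_ennreal_eq) auto
    qed
  qed (use that in \<open>auto simp: positive_def ca_empty[OF assms(1)] sets.sigma_algebra_axioms\<close>)
  show "sets N = sets M" by (simp add: N_def)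
  show "finite_measure N"
    by (rule finite_measureI) (simp add: em N_def[THEN meta_eq_to_obj_eq, THEN arg_cong, of space])
  show "A \<in> sets M \<Longrightarrow> emeasure N A = ennreal (?f A)" by (rule em)
qed

lemma sets_pos_part [simp, measurable_cong]: "sets (pos_part M \<mu>) = sets M"
  and sets_neg_part [simp, measurable_cong]: "sets (neg_part M \<mu>) = sets M"
  by (simp_all add: pos_part_def neg_part_def)

text \<open>The Jordan parts are finite measures with difference mu, so the Hahn decomposition for a
  pair of unsigned measures supplies \<open>S\<close>. Comparing the parts on subsets of
  \<open>S\<close> and of its complement gives the sign of mu there; hence |mu| is mu on
  \<open>S\<close> and -mu off \<open>S\<close>, and each half-sum
  \<open>(|mu| \<plusminus> mu) / 2\<close> collapses to |mu| restricted to one side.\<close>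

lemma hahn_decomposition:
  assumes mu: "\<mu> \<in> ca M"
  obtains S where "S \<in> sets M" "pos_part M \<mu> = density (tv M \<mu>) (indicator S)"
    "neg_part M \<mu> = density (tv M \<mu>) (indicator (space M - S))"
proof -
  interpret tv: finite_measure "tv M \<mu>" by (rule finite_measure_tv[OF mu])
  let ?p = "pos_part M \<mu>" and ?n = "neg_part M \<mu>"
  have p: "emeasure ?p A = ennreal ((measure (tv M \<mu>) A + \<mu> A) / 2)"
    and n: "emeasure ?n A = ennreal ((measure (tv M \<mu>) A - \<mu> A) / 2)" if "A \<in> sets M" for A
    using half_tv_measure(3)[OF mu _ that, of 1] half_tv_measure(3)[OF mu _ that, of "-1"]
    by (simp_all add: pos_part_def neg_part_def)
  have fin: "finite_measure ?p" "finite_measure ?n"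
    using half_tv_measure(2)[OF mu, of 1] half_tv_measure(2)[OF mu, of "-1"]
    by (simp_all add: pos_part_def neg_part_def)
  have le: "\<bar>\<mu> A\<bar> \<le> measure (tv M \<mu>) A" if "A \<in> sets M" for A
    by (rule abs_le_tv[OF mu that])
  obtain S where S: "S \<in> sets M"
    "\<And>X. X \<in> sets M \<Longrightarrow> X \<subseteq> S \<Longrightarrow> emeasure ?n X \<le> emeasure ?p X"
    "\<And>X. X \<in> sets M \<Longrightarrow> X \<inter> S = {} \<Longrightarrow> emeasure ?p X \<le> emeasure ?n X"
    using finite_unsigned_Hahn_decomposition[OF fin] by auto
  have mu_S: "0 \<le> \<mu> X" if "X \<in> sets M" "X \<subseteq> S" for X
    using S(2)[OF that] le[OF that(1)] by (simp add: p n that ennreal_le_iff)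
  have mu_S': "\<mu> X \<le> 0" if "X \<in> sets M" "X \<inter> S = {}" for X
    using S(3)[OF that] le[OF that(1)] by (simp add: p n that ennreal_le_iff)
  have tv_S: "measure (tv M \<mu>) X = \<mu> X" if "X \<in> sets M" "X \<subseteq> S" for X
  proof -
    have "emeasure (tv M \<mu>) X = ennreal (\<mu> X)"
      unfolding emeasure_tv[OF mu that(1)] using that mu_S by (intro total_var_nonneg[OF mu]) auto
    then show ?thesis using mu_S[OF that] by (simp add: measure_def)
  qed
  have tv_S': "measure (tv M \<mu>) X = - \<mu> X" if "X \<in> sets M" "X \<inter> S = {}" for X
  proof -
    \<comment> \<open>Off \<open>S\<close> the nonnegative set function is -mu, which has the same
      total variation as mu.\<close>
    have tv_minus: "total_var M (\<lambda>A. - \<mu> A) = total_var M \<mu>"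
      by (simp add: total_var_def fun_eq_iff)
    have "tv M (\<lambda>A. - \<mu> A) = tv M \<mu>" by (simp add: tv_def)
    then have "(\<lambda>A. - \<mu> A) \<in> ca M" using mu by (auto simp: ca_def intro!: sums_minus)
    then have "total_var M (\<lambda>A. - \<mu> A) X = ennreal (- \<mu> X)"
      using that mu_S' by (intro total_var_nonneg) auto
    then have "emeasure (tv M \<mu>) X = ennreal (- \<mu> X)"
      unfolding emeasure_tv[OF mu that(1)] tv_minus .
    then show ?thesis using mu_S'[OF that] by (simp add: measure_def)
  qed
  have split: "\<mu> A = \<mu> (A \<inter> S) + \<mu> (A - S)"
    "measure (tv M \<mu>) A = measure (tv M \<mu>) (A \<inter> S) + measure (tv M \<mu>) (A - S)"
    if "A \<in> sets M" for A
  proof -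
    have "A = (A \<inter> S) \<union> (A - S)" by auto
    then show "\<mu> A = \<mu> (A \<inter> S) + \<mu> (A - S)"
      using ca_Un[OF mu, of "A \<inter> S" "A - S"] that S(1) by auto
    show "measure (tv M \<mu>) A = measure (tv M \<mu>) (A \<inter> S) + measure (tv M \<mu>) (A - S)"
      using tv.finite_measure_Union[of "A \<inter> S" "A - S"] that S(1) \<open>A = (A \<inter> S) \<union> (A - S)\<close> by auto
  qed
  have half: "(measure (tv M \<mu>) A + \<mu> A) / 2 = measure (tv M \<mu>) (S \<inter> A)"
    "(measure (tv M \<mu>) A - \<mu> A) / 2 = measure (tv M \<mu>) ((space M - S) \<inter> A)" if "A \<in> sets M" for A
  proof -
    have "(space M - S) \<inter> A = A - S" using sets.sets_into_space[OF that] by auto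
    moreover have "measure (tv M \<mu>) (A \<inter> S) = \<mu> (A \<inter> S)" "measure (tv M \<mu>) (A - S) = - \<mu> (A - S)"
      using that S(1) by (auto intro!: tv_S tv_S')
    ultimately show "(measure (tv M \<mu>) A + \<mu> A) / 2 = measure (tv M \<mu>) (S \<inter> A)"
      "(measure (tv M \<mu>) A - \<mu> A) / 2 = measure (tv M \<mu>) ((space M - S) \<inter> A)"
      using split[OF that] by (simp_all add: Int_commute)
  qed
  show ?thesis
  proof
    show "?p = density (tv M \<mu>) (indicator S)"
      using S(1) by (intro measure_eqI)
        (auto simp: p half emeasure_density indicator_inter_arith[symmetric] tv.emeasure_eq_measure)
    show "?n = density (tv M \<mu>) (indicator (space M - S))"
      using S(1) by (intro measure_eqI)
        (auto simp: n half emeasure_density indicator_inter_arith[symmetric] tv.emeasure_eq_measure)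
  qed (fact S(1))
qed

text \<open>The function \<open>s\<close> is the density of mu with respect to |mu|: 1 on the Hahn
  set and -1 on the rest of the space. One \<open>s\<close> works for all integrable classes
  simultaneously.\<close>

lemma sint_eq_integral_tv:
  assumes mu: "\<mu> \<in> ca M"
  obtains s where "s \<in> borel_measurable M" "\<And>x. x \<in> space M \<Longrightarrow> \<bar>s x :: real\<bar> = 1"
    "\<And>X. integrable (tv M \<mu>) (L0_rep X) \<Longrightarrow> sint M \<mu> X = (\<integral>x. s x * L0_rep X x \<partial>tv M \<mu>)"
proof -
  obtain S where S: "S \<in> sets M" "pos_part M \<mu> = density (tv M \<mu>) (indicator S)"
    "neg_part M \<mu> = density (tv M \<mu>) (indicator (space M - S))"
    by (rule hahn_decomposition[OF mu])
  define s :: "'a \<Rightarrow> real" where "s x = indicator S x - indicator (space M - S) x" for x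
  show ?thesis
  proof
    show "s \<in> borel_measurable M" unfolding s_def using S(1) by measurable
    show "\<bar>s x\<bar> = 1" if "x \<in> space M" for x using that by (auto simp: s_def indicator_def)
    fix X assume int: "integrable (tv M \<mu>) (L0_rep X)"
    have [measurable]: "S \<in> sets M" "L0_rep X \<in> borel_measurable M"
      using S(1) int by (auto dest: borel_measurable_integrable)
    \<comment> \<open>\<open>integral_density\<close> expects the density as a real function coerced
      to \<open>ennreal\<close>.\<close>
    have ind: "density (tv M \<mu>) (indicator T) = density (tv M \<mu>) (\<lambda>x. ennreal (indicator T x))" for T
      by (simp add: ennreal_indicator)
    have "sint M \<mu> X = (\<integral>x. indicator S x * L0_rep X x \<partial>tv M \<mu>)
        - (\<integral>x. indicator (space M - S) x * L0_rep X x \<partial>tv M \<mu>)"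
      unfolding sint_def S(2,3) ind by (subst (1 2) integral_density) auto
    also have "\<dots> = (\<integral>x. indicator S x * L0_rep X x - indicator (space M - S) x * L0_rep X x \<partial>tv M \<mu>)"
      using int by (intro Bochner_Integration.integral_diff[symmetric] integrable_real_mult_indicator[unfolded mult.commute[of _ "indicator _ _"]]) auto
    finally show "sint M \<mu> X = (\<integral>x. s x * L0_rep X x \<partial>tv M \<mu>)"
      by (simp add: s_def left_diff_distrib)
  qed
qed

text \<open>For a finite measure all partition sums of \<open>A\<close> equal
  \<open>emeasure N A\<close>, so passing to a set function and back through \<open>tv\<close> loses
  nothing.\<close>

lemma measure_in_ca:
  assumes "finite_measure N" "sets N = sets M"
  shows "measure N \<in> ca M" "tv M (measure N) = N" "measure N \<in> ca_plus M"
proof -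
  interpret finite_measure N by fact
  have sums: "(\<lambda>i. measure N (A i)) sums measure N (\<Union>i. A i)"
    if "range A \<subseteq> sets M" "disjoint_family A" for A :: "nat \<Rightarrow> 'a set"
    using that assms by (intro finite_measure_UNION) auto
  have "(\<Sum>B\<in>D. ennreal \<bar>measure N B\<bar>) \<le> emeasure N A"
    if "A \<in> sets M" "finite D" "D \<subseteq> sets M" "partition_on A D" for A D
  proof -
    have "(\<Sum>B\<in>D. ennreal \<bar>measure N B\<bar>) = (\<Sum>B\<in>D. emeasure N B)"
      by (simp add: emeasure_eq_measure)
    also have "\<dots> = emeasure N (\<Union>B\<in>D. B)"
      using that assms(2) by (intro sum_emeasure) (auto simp: partition_on_def disjoint_def disjoint_family_on_def)
    also have "(\<Union>B\<in>D. B) = A" using that by (auto simp: partition_on_def)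
    finally show ?thesis by simp
  qed
  then have le: "total_var M (measure N) A \<le> emeasure N A" if "A \<in> sets M" for A
    unfolding total_var_def using that by (intro SUP_least) auto
  have ge: "emeasure N A \<le> total_var M (measure N) A" if "A \<in> sets M" for A
    using sum_le_total_var[of "measure N" "{()}" "\<lambda>_. A" M A] that
    by (simp add: disjoint_family_on_def emeasure_eq_measure)
  have "tv M (measure N) = measure_of (space M) (sets M) (emeasure N)"
    unfolding tv_def total_var_def[symmetric]
    by (rule measure_of_eq) (auto simp: sets.space_closed sets.sigma_sets_eq intro!: antisym le ge)
  also have "\<dots> = N"
    using measure_of_of_measure[of N] assms(2) sets_eq_imp_space_eq[OF assms(2)] by simp
  finally show tv: "tv M (measure N) = N" .
  show ca: "measure N \<in> ca M"
    unfolding ca_def using sums assms(2) tv emeasure_finite[of "space M"]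
    by (auto simp: measure_notin_sets less_top[symmetric])
  show "measure N \<in> ca_plus M" using ca by (simp add: ca_plus_def)
qed

lemma sint_ca_plus:
  assumes "\<mu> \<in> ca_plus M"
  shows "sint M \<mu> X = (\<integral>x. L0_rep X x \<partial>tv M \<mu>)"
proof -
  have mu: "\<mu> \<in> ca M" "\<And>A. A \<in> sets M \<Longrightarrow> 0 \<le> \<mu> A" using assms by (auto simp: ca_plus_def)
  interpret tv: finite_measure "tv M \<mu>" by (rule finite_measure_tv[OF mu(1)])
  have m: "measure (tv M \<mu>) A = \<mu> A" if "A \<in> sets M" for A
    using that mu by (simp add: measure_def emeasure_tv total_var_nonneg)
  have "pos_part M \<mu> = tv M \<mu>"
    using half_tv_measure(3)[OF mu(1), of 1]
    by (intro measure_eqI) (auto simp: pos_part_def m tv.emeasure_eq_measure)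
  moreover have "neg_part M \<mu> = null_measure M"
    using half_tv_measure(3)[OF mu(1), of "-1"]
    by (intro measure_eqI) (auto simp: neg_part_def m)
  ultimately show ?thesis by (simp add: sint_def)
qed

lemma integrable_sign_mult:
  fixes f :: "'a \<Rightarrow> real"
  assumes "integrable N f" "s \<in> borel_measurable N" "\<And>x. x \<in> space N \<Longrightarrow> \<bar>s x\<bar> = 1"
  shows "integrable N (\<lambda>x. s x * f x)"
proof (rule Bochner_Integration.integrable_bound[OF assms(1)])
  show "(\<lambda>x. s x * f x) \<in> borel_measurable N"
    using assms(1,2) by (auto dest: borel_measurable_integrable)
  show "AE x in N. norm (s x * f x) \<le> norm (f x)"
    using assms(3) by (intro AE_I2) (simp add: abs_mult)
qed

section \<open>Classes and representatives\<close>

text \<open>Membership in \<open>H\<close> is expressed for functions instead of classes, so that it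
  can be proved by induction over Borel sets and over measurable functions.\<close>

definition reps ::
    "'a measure \<Rightarrow> 'a measure set \<Rightarrow> ('a \<Rightarrow> real) set set \<Rightarrow> ('a \<Rightarrow> real) set" where
  "reps M PP H = {f \<in> borel_measurable M. L0_class M PP f \<in> H}"

locale quasi_sure =
  fixes M :: "'a measure" and PP :: "'a measure set"
  assumes nonempty: "PP \<noteq> {}"
    and prob: "P \<in> PP \<Longrightarrow> prob_space P"
    and sets_PP: "P \<in> PP \<Longrightarrow> sets P = sets M"
begin

text \<open>The supremum of the almost-everywhere filters encodes "for every P in \<open>PP\<close>,
  P-almost surely", which makes the usual filter reasoning available for quasi-sure
  statements.\<close>

definition qs :: "'a filter" where
  "qs = (SUP P\<in>PP. ae_filter P)"

lemma eventually_qs: "eventually p qs \<longleftrightarrow> (\<forall>P\<in>PP. AE x in P. p x)"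
  by (simp add: qs_def eventually_Sup)

lemma space_PP: "P \<in> PP \<Longrightarrow> space P = space M"
  by (rule sets_eq_imp_space_eq) (rule sets_PP)

lemma measurable_PP: "P \<in> PP \<Longrightarrow> borel_measurable P = borel_measurable M"
  by (intro measurable_cong_sets sets_PP refl)

lemma qs_space: "\<forall>\<^sub>F x in qs. x \<in> space M"
  unfolding eventually_qs by (metis AE_space space_PP)

lemma qs_all_countable:
  "(\<forall>\<^sub>F x in qs. \<forall>i. p i x) \<longleftrightarrow> (\<forall>i :: 'i :: countable. \<forall>\<^sub>F x in qs. p i x)"
  by (auto simp: eventually_qs AE_all_countable)

section \<open>Passing between classes and representatives\<close>

lemma mem_L0_class:
  "g \<in> L0_class M PP f \<longleftrightarrow>
     f \<in> borel_measurable M \<and> g \<in> borel_measurable M \<and> (\<forall>\<^sub>F x in qs. f x = g x)"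
  by (simp add: L0_class_def qs_eq_def eventually_qs)

lemma L0_class_self: "f \<in> borel_measurable M \<Longrightarrow> f \<in> L0_class M PP f"
  by (simp add: mem_L0_class)

lemma L0_class_eqI:
  assumes "f \<in> borel_measurable M" "g \<in> borel_measurable M" "\<forall>\<^sub>F x in qs. f x = g x"
  shows "L0_class M PP f = L0_class M PP g"
proof -
  have "h \<in> L0_class M PP f \<longleftrightarrow> h \<in> L0_class M PP g" for h
    using assms by (auto simp: mem_L0_class elim: eventually_elim2)
  then show ?thesis by blast
qed

lemma rep_class:
  assumes "f \<in> borel_measurable M"
  shows "L0_rep (L0_class M PP f) \<in> borel_measurable M"
    "\<forall>\<^sub>F x in qs. L0_rep (L0_class M PP f) x = f x"
proof -
  have "L0_rep (L0_class M PP f) \<in> L0_class M PP f"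
    unfolding L0_rep_def
    by (rule someI[where P = "\<lambda>g. g \<in> L0_class M PP f"]) (rule L0_class_self[OF assms])
  then show "L0_rep (L0_class M PP f) \<in> borel_measurable M"
    "\<forall>\<^sub>F x in qs. L0_rep (L0_class M PP f) x = f x"
    by (auto simp: mem_L0_class elim: eventually_mono)
qed

lemma L0_class_in_L0: "f \<in> borel_measurable M \<Longrightarrow> L0_class M PP f \<in> L0 M PP"
  unfolding L0_def L0_class_def by (rule quotientI)

lemma L0_rep:
  assumes "X \<in> L0 M PP"
  shows "L0_rep X \<in> borel_measurable M" "L0_class M PP (L0_rep X) = X"
proof -
  obtain f where f: "f \<in> borel_measurable M" "X = L0_class M PP f"
    using assms by (auto simp: L0_def L0_class_def elim: quotientE)
  show "L0_rep X \<in> borel_measurable M" unfolding f(2) by (rule rep_class(1)[OF f(1)])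
  show "L0_class M PP (L0_rep X) = X"
    unfolding f(2) using f(1) by (intro L0_class_eqI rep_class)
qed

text \<open>The operations are defined through arbitrarily chosen representatives; these identities
  allow computing with any representative at hand.\<close>

lemma class_arith:
  assumes [measurable]: "f \<in> borel_measurable M" "g \<in> borel_measurable M"
  shows "L0_add M PP (L0_class M PP f) (L0_class M PP g) = L0_class M PP (\<lambda>x. f x + g x)"
    "L0_diff M PP (L0_class M PP f) (L0_class M PP g) = L0_class M PP (\<lambda>x. f x - g x)"
    "L0_sup M PP (L0_class M PP f) (L0_class M PP g) = L0_class M PP (\<lambda>x. max (f x) (g x))"
    "L0_inf M PP (L0_class M PP f) (L0_class M PP g) = L0_class M PP (\<lambda>x. min (f x) (g x))"
proof -
  note [measurable] = rep_class(1)[OF assms(1)] rep_class(1)[OF assms(2)]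
  have ev: "\<forall>\<^sub>F x in qs. L0_rep (L0_class M PP f) x = f x \<and> L0_rep (L0_class M PP g) x = g x"
    by (intro eventually_conj rep_class assms)
  show "L0_add M PP (L0_class M PP f) (L0_class M PP g) = L0_class M PP (\<lambda>x. f x + g x)"
    unfolding L0_add_def
    by (rule L0_class_eqI, measurable, rule eventually_mono[OF ev]) simp
  show "L0_diff M PP (L0_class M PP f) (L0_class M PP g) = L0_class M PP (\<lambda>x. f x - g x)"
    unfolding L0_diff_def
    by (rule L0_class_eqI, measurable, rule eventually_mono[OF ev]) simp
  show "L0_sup M PP (L0_class M PP f) (L0_class M PP g) = L0_class M PP (\<lambda>x. max (f x) (g x))"
    unfolding L0_sup_def
    by (rule L0_class_eqI, measurable, rule eventually_mono[OF ev]) simp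
  show "L0_inf M PP (L0_class M PP f) (L0_class M PP g) = L0_class M PP (\<lambda>x. min (f x) (g x))"
    unfolding L0_inf_def
    by (rule L0_class_eqI, measurable, rule eventually_mono[OF ev]) simp
qed

lemma class_scale_abs:
  assumes [measurable]: "f \<in> borel_measurable M"
  shows "L0_scale M PP c (L0_class M PP f) = L0_class M PP (\<lambda>x. c * f x)"
    "L0_abs M PP (L0_class M PP f) = L0_class M PP (\<lambda>x. \<bar>f x\<bar>)"
proof -
  note [measurable] = rep_class(1)[OF assms]
  show "L0_scale M PP c (L0_class M PP f) = L0_class M PP (\<lambda>x. c * f x)"
    unfolding L0_scale_def
    by (rule L0_class_eqI, measurable, rule eventually_mono[OF rep_class(2)[OF assms]]) simp
  show "L0_abs M PP (L0_class M PP f) = L0_class M PP (\<lambda>x. \<bar>f x\<bar>)"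
    unfolding L0_abs_def
    by (rule L0_class_eqI, measurable, rule eventually_mono[OF rep_class(2)[OF assms]]) simp
qed

lemma le_class:
  assumes "f \<in> borel_measurable M" "g \<in> borel_measurable M"
  shows "L0_le PP (L0_class M PP f) (L0_class M PP g) \<longleftrightarrow> (\<forall>\<^sub>F x in qs. f x \<le> g x)"
proof
  assume "L0_le PP (L0_class M PP f) (L0_class M PP g)"
  then show "\<forall>\<^sub>F x in qs. f x \<le> g x"
    using L0_class_self[OF assms(1)] L0_class_self[OF assms(2)]
    by (auto simp: L0_le_def eventually_qs)
next
  assume le: "\<forall>\<^sub>F x in qs. f x \<le> g x"
  have "\<forall>\<^sub>F x in qs. h x \<le> k x" if "h \<in> L0_class M PP f" "k \<in> L0_class M PP g" for h k
  proof -
    have "\<forall>\<^sub>F x in qs. f x = h x" "\<forall>\<^sub>F x in qs. g x = k x"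
      using that by (auto simp: mem_L0_class)
    with le show ?thesis by eventually_elim simp
  qed
  then show "L0_le PP (L0_class M PP f) (L0_class M PP g)"
    by (auto simp: L0_le_def eventually_qs)
qed

lemma le_L0:
  assumes "X \<in> L0 M PP" "Y \<in> L0 M PP"
  shows "L0_le PP X Y \<longleftrightarrow> (\<forall>\<^sub>F x in qs. L0_rep X x \<le> L0_rep Y x)"
  using le_class[OF L0_rep(1)[OF assms(1)] L0_rep(1)[OF assms(2)]] assms by (simp add: L0_rep)

lemma repsD: "f \<in> reps M PP H \<Longrightarrow> f \<in> borel_measurable M" "f \<in> reps M PP H \<Longrightarrow> L0_class M PP f \<in> H"
  by (simp_all add: reps_def)

lemma reps_cong:
  assumes "f \<in> reps M PP H" "g \<in> borel_measurable M" "\<forall>\<^sub>F x in qs. f x = g x"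
  shows "g \<in> reps M PP H"
  using assms L0_class_eqI[of f g] by (simp add: reps_def)

lemma rep_in_reps: "H \<subseteq> L0 M PP \<Longrightarrow> X \<in> H \<Longrightarrow> L0_rep X \<in> reps M PP H"
  using L0_rep[of X] by (auto simp: reps_def)

lemma reps_scale:
  assumes "L0_subspace M PP H" "f \<in> reps M PP H"
  shows "(\<lambda>x. c * f x) \<in> reps M PP H"
proof -
  note [measurable] = repsD(1)[OF assms(2)]
  have "L0_scale M PP c (L0_class M PP f) \<in> H"
    using assms by (simp add: reps_def L0_subspace_def)
  then show ?thesis by (simp add: reps_def class_scale_abs)
qed

lemma reps_add:
  assumes "L0_subspace M PP H" "f \<in> reps M PP H" "g \<in> reps M PP H"
  shows "(\<lambda>x. f x + g x) \<in> reps M PP H"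
proof -
  note [measurable] = repsD(1)[OF assms(2)] repsD(1)[OF assms(3)]
  have "L0_add M PP (L0_class M PP f) (L0_class M PP g) \<in> H"
    using assms by (simp add: reps_def L0_subspace_def)
  then show ?thesis by (simp add: reps_def class_arith)
qed

lemma reps_diff:
  assumes "L0_subspace M PP H" "f \<in> reps M PP H" "g \<in> reps M PP H"
  shows "(\<lambda>x. f x - g x) \<in> reps M PP H"
  using reps_add[OF assms(1,2) reps_scale[OF assms(1,3), of "-1"]] by simp

text \<open>Domination speaks only about measurable null sets. Measurability of \<open>p\<close>
  makes its exceptional set one; it is null for each P in \<open>PP\<close>, hence for |mu|.\<close>

lemma AE_ca_of:
  assumes "\<mu> \<in> ca_of M PP" "Measurable.pred M p" "\<forall>\<^sub>F x in qs. p x"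
  shows "AE x in tv M \<mu>. p x"
proof -
  define N where "N = {x \<in> space M. \<not> p x}"
  have N: "N \<in> sets M" unfolding N_def using assms(2) by measurable
  have "emeasure (tv M \<nu>) N = 0" if "\<nu> \<in> measure ` PP" for \<nu>
  proof -
    obtain P where P: "P \<in> PP" "\<nu> = measure P" using \<open>\<nu> \<in> measure ` PP\<close> by (rule imageE)
    interpret P: prob_space P by (rule prob[OF P(1)])
    have "emeasure P N = 0"
      using assms(2,3) P(1) N unfolding eventually_qs
      by (subst AE_iff_measurable[symmetric, where P = p]) (auto simp: N_def space_PP sets_PP)
    then show ?thesis
      using measure_in_ca(2)[OF P.finite_measure_axioms sets_PP[OF P(1)]] P(2) by simp
  qed
  then have "(SUP \<nu>\<in>measure ` PP. emeasure (tv M \<nu>) N) = 0"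
    by (simp add: SUP_eq_const nonempty)
  then have "emeasure (tv M \<mu>) N = 0"
    using assms(1) N by (auto simp: ca_of_def dominated_def)
  then show ?thesis
    using N by (subst AE_iff_measurable) (auto simp: N_def)
qed

lemma measure_in_ca_of:
  assumes "P \<in> PP"
  shows "measure P \<in> ca_of M PP" "tv M (measure P) = P" "measure P \<in> ca_plus M"
proof -
  interpret P: prob_space P by (rule prob[OF assms])
  note m = measure_in_ca[OF P.finite_measure_axioms sets_PP[OF assms]]
  show "tv M (measure P) = P" "measure P \<in> ca_plus M" by (fact m)+
  have "emeasure (tv M (measure P)) N = 0" if "(SUP \<nu>\<in>measure ` PP. emeasure (tv M \<nu>) N) = 0" for N
  proof -
    have "emeasure (tv M (measure P)) N \<le> (SUP \<nu>\<in>measure ` PP. emeasure (tv M \<nu>) N)"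
      by (rule SUP_upper) (rule imageI[OF assms])
    then show ?thesis unfolding that by simp
  qed
  then show "measure P \<in> ca_of M PP"
    using m(1) by (simp add: ca_of_def dominated_def)
qed

lemma rep_arith:
  assumes "X \<in> L0 M PP" "Y \<in> L0 M PP"
  shows "\<forall>\<^sub>F x in qs. L0_rep (L0_add M PP X Y) x = L0_rep X x + L0_rep Y x"
    "\<forall>\<^sub>F x in qs. L0_rep (L0_diff M PP X Y) x = L0_rep X x - L0_rep Y x"
    "\<forall>\<^sub>F x in qs. L0_rep (L0_scale M PP c X) x = c * L0_rep X x"
proof -
  note [measurable] = L0_rep(1)[OF assms(1)] L0_rep(1)[OF assms(2)]
  show "\<forall>\<^sub>F x in qs. L0_rep (L0_add M PP X Y) x = L0_rep X x + L0_rep Y x"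
    unfolding L0_add_def by (rule rep_class) measurable
  show "\<forall>\<^sub>F x in qs. L0_rep (L0_diff M PP X Y) x = L0_rep X x - L0_rep Y x"
    unfolding L0_diff_def by (rule rep_class) measurable
  show "\<forall>\<^sub>F x in qs. L0_rep (L0_scale M PP c X) x = c * L0_rep X x"
    unfolding L0_scale_def by (rule rep_class) measurable
qed

lemma integral_cong_ca_of:
  fixes f g :: "'a \<Rightarrow> real"
  assumes "\<mu> \<in> ca_of M PP" and [measurable]: "f \<in> borel_measurable M" "g \<in> borel_measurable M"
    and "\<forall>\<^sub>F x in qs. f x = g x"
  shows "(\<integral>x. f x \<partial>tv M \<mu>) = (\<integral>x. g x \<partial>tv M \<mu>)" "integrable (tv M \<mu>) f \<longleftrightarrow> integrable (tv M \<mu>) g"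
proof -
  have "AE x in tv M \<mu>. f x = g x"
    by (rule AE_ca_of[OF assms(1) _ assms(4)]) measurable
  then show "(\<integral>x. f x \<partial>tv M \<mu>) = (\<integral>x. g x \<partial>tv M \<mu>)" "integrable (tv M \<mu>) f \<longleftrightarrow> integrable (tv M \<mu>) g"
    using integral_cong_AE[of f "tv M \<mu>" g] integrable_cong_AE[of f "tv M \<mu>" g] by simp_all
qed

end

section \<open>The robust Orlicz space\<close>

text \<open>Convexity between 0 and a point \<open>z\<close> beyond \<open>b\<close> gives
  \<open>\<phi> z\<close> \<ge> (z/b) \<open>\<phi> b\<close>, because \<open>\<phi> 0 = 0\<close>.
  Below \<open>b\<close> the function may vanish, which is why the minorant starts at
  \<open>b\<close>.\<close>

lemma orlicz_function_linear_bound: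
  assumes "orlicz_function \<phi>"
  obtains a b where "0 < a" "0 < b" "\<And>z. 0 \<le> z \<Longrightarrow> ennreal (a * max 0 (z - b)) \<le> \<phi> z"
proof -
  obtain b where b: "0 < b" "0 < \<phi> b" using assms by (auto simp: orlicz_function_def)
  \<comment> \<open>\<open>\<phi> b\<close> may be infinite; cutting at 1 leaves a positive real
    lower bound.\<close>
  define c where "c = enn2real (min 1 (\<phi> b))"
  have c: "0 < c" "ennreal c \<le> \<phi> b"
    using b(2) by (cases "\<phi> b"; force simp: c_def min_def enn2real_positive_iff)+
  show ?thesis
  proof
    show "0 < c / b" using b c by simp
    fix z :: real assume z: "0 \<le> z"
    show "ennreal (c / b * max 0 (z - b)) \<le> \<phi> z"
    proof (cases "z \<le> b")
      case False
      \<comment> \<open>The weight that places \<open>b\<close> on the segment from 0 to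
        \<open>z\<close>.\<close>
      define t where "t = b / z"
      have t: "0 < t" "t \<le> 1" "t * z = b" using False b(1) by (auto simp: t_def)
      have "\<phi> ((1 - t) * 0 + t * z) \<le> ennreal (1 - t) * \<phi> 0 + ennreal t * \<phi> z"
        using assms z t unfolding orlicz_function_def by (auto simp del: mult_zero_right)
      then have "\<phi> b \<le> ennreal t * \<phi> z"
        using assms t by (simp add: orlicz_function_def)
      then have "ennreal (1 / t) * ennreal c \<le> ennreal (1 / t) * (ennreal t * \<phi> z)"
        by (intro mult_left_mono order_trans[OF c(2)]) auto
      also have "\<dots> = \<phi> z"
        using t by (simp add: mult.assoc[symmetric] ennreal_mult[symmetric])
      finally have "ennreal (1 / t * c) \<le> \<phi> z"
        using t c by (simp add: ennreal_mult[symmetric] less_imp_le)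
      moreover have "c / b * max 0 (z - b) \<le> 1 / t * c"
        using False b c by (simp add: t_def field_simps)
      ultimately show ?thesis by (meson ennreal_leI order_trans)
    qed simp
  qed (fact b(1))
qed

locale orlicz_setting = quasi_sure +
  fixes \<Phi> :: "'a measure \<Rightarrow> real \<Rightarrow> ennreal"
  assumes orlicz: "P \<in> PP \<Longrightarrow> orlicz_function (\<Phi> P)"
    and Linf_le: "Linf M PP \<subseteq> orlicz_space M PP \<Phi>"
begin

section \<open>Monotonicity of the Orlicz norm and its comparison with L1 norms\<close>

lemma orlicz_norm_mono:
  assumes "f \<in> borel_measurable M" "g \<in> borel_measurable M" "\<forall>\<^sub>F x in qs. \<bar>f x\<bar> \<le> \<bar>g x\<bar>"
  shows "orlicz_norm PP \<Phi> (L0_class M PP f) \<le> orlicz_norm PP \<Phi> (L0_class M PP g)"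
proof -
  have "(SUP P\<in>PP. \<integral>\<^sup>+x. \<Phi> P (inverse l * \<bar>L0_rep (L0_class M PP f) x\<bar>) \<partial>P)
      \<le> (SUP P\<in>PP. \<integral>\<^sup>+x. \<Phi> P (inverse l * \<bar>L0_rep (L0_class M PP g) x\<bar>) \<partial>P)"
    if "0 < l" for l
  proof (rule SUP_mono)
    fix P assume P: "P \<in> PP"
    have ev: "\<forall>\<^sub>F x in qs. \<bar>L0_rep (L0_class M PP f) x\<bar> \<le> \<bar>L0_rep (L0_class M PP g) x\<bar>"
      using assms(3) rep_class(2)[OF assms(1)] rep_class(2)[OF assms(2)]
      by eventually_elim simp
    have "mono_on {0..} (\<Phi> P)" using orlicz[OF P] by (simp add: orlicz_function_def)
    have mono: "\<Phi> P (inverse l * \<bar>u\<bar>) \<le> \<Phi> P (inverse l * \<bar>v\<bar>)" if "\<bar>u\<bar> \<le> \<bar>v\<bar>" for u v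
      using \<open>0 < l\<close> that by (intro mono_onD[OF \<open>mono_on _ _\<close>] mult_left_mono) simp_all
    have "(\<integral>\<^sup>+x. \<Phi> P (inverse l * \<bar>L0_rep (L0_class M PP f) x\<bar>) \<partial>P)
        \<le> (\<integral>\<^sup>+x. \<Phi> P (inverse l * \<bar>L0_rep (L0_class M PP g) x\<bar>) \<partial>P)"
      by (rule nn_integral_mono_AE, rule eventually_mono[OF ev[unfolded eventually_qs, rule_format, OF P]])
        (rule mono)
    with P show "\<exists>P'\<in>PP. (\<integral>\<^sup>+x. \<Phi> P (inverse l * \<bar>L0_rep (L0_class M PP f) x\<bar>) \<partial>P)
        \<le> (\<integral>\<^sup>+x. \<Phi> P' (inverse l * \<bar>L0_rep (L0_class M PP g) x\<bar>) \<partial>P')"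
      by (rule bexI[rotated])
  qed
  then show ?thesis
    unfolding orlicz_norm_def by (intro Inf_superset_mono image_mono) (auto intro: order_trans)
qed

lemma orlicz_norm_cong:
  assumes "f \<in> borel_measurable M" "g \<in> borel_measurable M" "\<forall>\<^sub>F x in qs. \<bar>f x\<bar> = \<bar>g x\<bar>"
  shows "orlicz_norm PP \<Phi> (L0_class M PP f) = orlicz_norm PP \<Phi> (L0_class M PP g)"
  using assms by (intro antisym orlicz_norm_mono) (auto elim: eventually_mono)

lemma orlicz_space_subset_L0: "orlicz_space M PP \<Phi> \<subseteq> L0 M PP"
  by (auto simp: orlicz_space_def)

lemma orlicz_space_solid:
  assumes "g \<in> reps M PP (orlicz_space M PP \<Phi>)" "f \<in> borel_measurable M"
    "\<forall>\<^sub>F x in qs. \<bar>f x\<bar> \<le> \<bar>g x\<bar>"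
  shows "f \<in> reps M PP (orlicz_space M PP \<Phi>)"
  using assms orlicz_norm_mono[OF assms(2) repsD(1)[OF assms(1)] assms(3)]
  by (auto simp: reps_def orlicz_space_def L0_class_in_L0)

text \<open>Each P has its own \<open>k\<close>, since the minorant of \<open>\<Phi> P\<close>
  depends on P. With the nonnegative integral the same estimate yields both integrability of all
  elements and norm continuity of integration against P.\<close>

lemma L1_norm_bound:
  assumes P: "P \<in> PP"
  obtains k where "0 < k"
    "\<And>X. X \<in> L0 M PP \<Longrightarrow> ennreal k * (\<integral>\<^sup>+x. ennreal \<bar>L0_rep X x\<bar> \<partial>P) \<le> orlicz_norm PP \<Phi> X"
proof -
  interpret P: prob_space P by (rule prob[OF P])
  obtain a b where ab: "0 < a" "0 < b"
    "\<And>z. 0 \<le> z \<Longrightarrow> ennreal (a * max 0 (z - b)) \<le> \<Phi> P z"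
    using orlicz_function_linear_bound[OF orlicz[OF P]] by blast
  \<comment> \<open>If the scaling \<open>l\<close> is admissible, then a|X|/l \<le> ab + a max(0,
    |X|/l - b), and the last term has expectation at most 1. Thus E|X| \<le> l(ab + 1)/a, which is
    l/k.\<close>
  define k where "k = a / (a * b + 1)"
  have ab1: "0 < a * b + 1" using ab by (simp add: add_pos_pos)
  then have k: "0 < k" using ab by (simp add: k_def)
  show ?thesis
  proof
    show "0 < k" by (fact k)
    fix X assume X: "X \<in> L0 M PP"
    have [measurable]: "L0_rep X \<in> borel_measurable P"
      using L0_rep(1)[OF X] by (simp add: measurable_PP[OF P])
    show "ennreal k * (\<integral>\<^sup>+x. ennreal \<bar>L0_rep X x\<bar> \<partial>P) \<le> orlicz_norm PP \<Phi> X"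
      unfolding orlicz_norm_def
    proof (rule Inf_greatest, elim imageE CollectE conjE)
      fix y l assume y: "y = ennreal l" and l: "0 < l"
        and le: "(SUP P\<in>PP. \<integral>\<^sup>+x. \<Phi> P (inverse l * \<bar>L0_rep X x\<bar>) \<partial>P) \<le> 1"
      let ?z = "\<lambda>x. inverse l * \<bar>L0_rep X x\<bar>"
      have "(\<integral>\<^sup>+x. ennreal (a * max 0 (?z x - b)) \<partial>P) \<le> (\<integral>\<^sup>+x. \<Phi> P (?z x) \<partial>P)"
        using l by (intro nn_integral_mono ab(3)) simp
      also have "\<dots> \<le> 1" using le P by (auto simp: SUP_le_iff)
      finally have int: "(\<integral>\<^sup>+x. ennreal (a * max 0 (?z x - b)) \<partial>P) \<le> 1" .
      have "(\<integral>\<^sup>+x. ennreal (a * ?z x) \<partial>P) \<le> (\<integral>\<^sup>+x. ennreal (a * b) + ennreal (a * max 0 (?z x - b)) \<partial>P)"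
      proof (rule nn_integral_mono)
        fix x
        have "a * ?z x \<le> a * (b + max 0 (?z x - b))" using ab(1) by (intro mult_left_mono) auto
        then show "ennreal (a * ?z x) \<le> ennreal (a * b) + ennreal (a * max 0 (?z x - b))"
          using ab by (simp add: ennreal_plus[symmetric] distrib_left del: ennreal_plus)
      qed
      also have "\<dots> = ennreal (a * b) + (\<integral>\<^sup>+x. ennreal (a * max 0 (?z x - b)) \<partial>P)"
        by (subst nn_integral_add) (auto simp: P.emeasure_space_1)
      also have "\<dots> \<le> ennreal (a * b + 1)"
        using int ab by (simp add: ennreal_plus[symmetric] add_left_mono)
      finally have bound: "(\<integral>\<^sup>+x. ennreal (a * ?z x) \<partial>P) \<le> ennreal (a * b + 1)" .
      have "ennreal k * (\<integral>\<^sup>+x. ennreal \<bar>L0_rep X x\<bar> \<partial>P)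
          = (\<integral>\<^sup>+x. ennreal (l / (a * b + 1)) * ennreal (a * ?z x) \<partial>P)"
      proof (subst nn_integral_cmult[symmetric])
        have "k * u = l / (a * b + 1) * (a * (inverse l * u))" for u
          using l by (simp add: k_def)
        then show "(\<integral>\<^sup>+x. ennreal k * ennreal \<bar>L0_rep X x\<bar> \<partial>P)
            = (\<integral>\<^sup>+x. ennreal (l / (a * b + 1)) * ennreal (a * ?z x) \<partial>P)"
          using l ab ab1 k
          by (intro nn_integral_cong) (simp add: ennreal_mult[symmetric] less_imp_le del: times_divide_eq_left)
      qed simp
      also have "\<dots> = ennreal (l / (a * b + 1)) * (\<integral>\<^sup>+x. ennreal (a * ?z x) \<partial>P)"
        by (rule nn_integral_cmult) simp
      also have "\<dots> \<le> ennreal (l / (a * b + 1)) * ennreal (a * b + 1)"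
        by (rule mult_left_mono[OF bound]) simp
      also have "\<dots> = ennreal l"
        using l ab1 by (simp add: ennreal_mult[symmetric] less_imp_le)
      finally show "ennreal k * (\<integral>\<^sup>+x. ennreal \<bar>L0_rep X x\<bar> \<partial>P) \<le> y" by (simp add: y)
    qed
  qed
qed

lemma integrable_rep:
  assumes "P \<in> PP" "X \<in> orlicz_space M PP \<Phi>"
  shows "integrable P (L0_rep X)"
proof -
  have X: "X \<in> L0 M PP" "orlicz_norm PP \<Phi> X < \<infinity>" using assms(2) by (auto simp: orlicz_space_def)
  obtain k where "0 < k" "ennreal k * (\<integral>\<^sup>+x. ennreal \<bar>L0_rep X x\<bar> \<partial>P) \<le> orlicz_norm PP \<Phi> X"
    using L1_norm_bound[OF assms(1)] X by metis
  then have "ennreal k * (\<integral>\<^sup>+x. ennreal \<bar>L0_rep X x\<bar> \<partial>P) < \<infinity>" using X by (meson order_le_less_trans)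
  then have "(\<integral>\<^sup>+x. ennreal \<bar>L0_rep X x\<bar> \<partial>P) < \<infinity>"
    using \<open>0 < k\<close> by (auto simp: ennreal_mult_less_top)
  then show ?thesis
    using L0_rep(1)[OF X(1)] by (intro integrableI_bounded) (auto simp: measurable_PP[OF assms(1)])
qed

end

locale orlicz_subspace = orlicz_setting +
  fixes H
  assumes H_orlicz: "H \<subseteq> orlicz_space M PP \<Phi>"
    and H_subspace: "L0_subspace M PP H"
begin

lemma H_L0: "H \<subseteq> L0 M PP"
  using H_orlicz orlicz_space_subset_L0 by blast

lemma zero_reps: "(\<lambda>x. 0) \<in> reps M PP H"
  using H_subspace by (simp add: reps_def L0_subspace_def L0_zero_def)

lemmas H_scale = reps_scale[OF H_subspace]
  and H_add = reps_add[OF H_subspace]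
  and H_diff = reps_diff[OF H_subspace]

lemma rep_H: "X \<in> H \<Longrightarrow> L0_rep X \<in> reps M PP H" "X \<in> H \<Longrightarrow> L0_rep X \<in> borel_measurable M"
  using rep_in_reps[OF H_L0] L0_rep(1) H_L0 by auto

lemma class_rep_H: "X \<in> H \<Longrightarrow> L0_class M PP (L0_rep X) = X"
  using L0_rep(2) H_L0 by auto

lemma integrable_reps:
  assumes "\<mu> \<in> ca_of M PP" "\<forall>X\<in>H. integrable (tv M \<mu>) (L0_rep X)" "f \<in> reps M PP H"
  shows "integrable (tv M \<mu>) f"
proof -
  note f = repsD[OF assms(3)]
  show ?thesis
    using integral_cong_ca_of(2)[OF assms(1) rep_class(1)[OF f(1)] f(1) rep_class(2)[OF f(1)]]
      assms(2) f(2) by blast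
qed

lemma measure_in_ca_H:
  assumes P: "P \<in> PP"
  shows "measure P \<in> ca_H M PP \<Phi> H"
proof -
  obtain k where k: "0 < k"
    "\<And>X. X \<in> L0 M PP \<Longrightarrow> ennreal k * (\<integral>\<^sup>+x. ennreal \<bar>L0_rep X x\<bar> \<partial>P) \<le> orlicz_norm PP \<Phi> X"
    by (rule L1_norm_bound[OF P]) blast
  have int: "integrable P (L0_rep X)" if "X \<in> H" for X
    using integrable_rep[OF P] H_orlicz that by blast
  have "norm_continuous_on M PP \<Phi> H (\<lambda>X. \<integral>x. L0_rep X x \<partial>P)"
    unfolding norm_continuous_on_def
  proof (intro ballI allI impI)
    fix X and e :: real assume X: "X \<in> H" and e: "0 < e"
    \<comment> \<open>Integration against P is Lipschitz with constant 1/k, hence the radius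
      \<open>k * e\<close>.\<close>
    have "\<bar>(\<integral>x. L0_rep Y x \<partial>P) - (\<integral>x. L0_rep X x \<partial>P)\<bar> < e"
      if Y: "Y \<in> H" and less: "orlicz_norm PP \<Phi> (L0_diff M PP Y X) < ennreal (k * e)" for Y
    proof -
      define w where "w x = L0_rep Y x - L0_rep X x" for x
      have w: "integrable P w" unfolding w_def by (intro Bochner_Integration.integrable_diff int X Y)
      have wM: "w \<in> borel_measurable M" using w measurable_PP[OF P] by (auto dest: borel_measurable_integrable)
      have "AE x in P. L0_rep (L0_diff M PP Y X) x = w x"
        using rep_arith(2)[of Y X] X Y H_L0 P by (auto simp: eventually_qs w_def)
      then have "(\<integral>\<^sup>+x. ennreal \<bar>w x\<bar> \<partial>P) = (\<integral>\<^sup>+x. ennreal \<bar>L0_rep (L0_diff M PP Y X) x\<bar> \<partial>P)"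
        by (intro nn_integral_cong_AE) (auto elim: eventually_mono)
      also have "(\<integral>\<^sup>+x. ennreal \<bar>w x\<bar> \<partial>P) = ennreal (\<integral>x. \<bar>w x\<bar> \<partial>P)"
        using w by (intro nn_integral_eq_integral) auto
      finally have "ennreal k * ennreal (\<integral>x. \<bar>w x\<bar> \<partial>P) \<le> orlicz_norm PP \<Phi> (L0_diff M PP Y X)"
        using k(2)[of "L0_diff M PP Y X"] L0_class_in_L0[OF wM] by (simp add: L0_diff_def w_def[abs_def])
      with less have "ennreal (k * (\<integral>x. \<bar>w x\<bar> \<partial>P)) < ennreal (k * e)"
        using k(1) by (simp add: ennreal_mult)
      then have "k * (\<integral>x. \<bar>w x\<bar> \<partial>P) < k * e"
        by (rule ennreal_less_iff[THEN iffD1, rotated]) (use k(1) in simp)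
      then have "(\<integral>x. \<bar>w x\<bar> \<partial>P) < e" using k(1) by simp
      moreover have "(\<integral>x. L0_rep Y x \<partial>P) - (\<integral>x. L0_rep X x \<partial>P) = (\<integral>x. w x \<partial>P)"
        unfolding w_def by (rule Bochner_Integration.integral_diff[symmetric]) (intro int X Y)+
      ultimately show ?thesis using integral_abs_bound[of P w] by linarith
    qed
    then show "\<exists>d>0. \<forall>Y\<in>H. orlicz_norm PP \<Phi> (L0_diff M PP Y X) < ennreal d \<longrightarrow>
        \<bar>(\<integral>x. L0_rep Y x \<partial>P) - (\<integral>x. L0_rep X x \<partial>P)\<bar> < e"
      using k(1) e by (intro exI[of _ "k * e"]) auto
  qed
  then show ?thesis
    using measure_in_ca_of[OF P] int by (simp add: ca_H_def)
qed

end

section \<open>Ideals\<close>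

locale orlicz_ideal = orlicz_setting +
  fixes H
  assumes ideal: "ideal_in M PP (orlicz_space M PP \<Phi>) H"

sublocale orlicz_ideal \<subseteq> orlicz_subspace
  by standard (use ideal in \<open>auto simp: ideal_in_def\<close>)

context orlicz_ideal
begin

text \<open>The ideal property tests only classes already in the Orlicz space; solidity of that
  space provides this membership, leaving the pointwise domination as the only thing to
  check.\<close>

lemma solid_reps:
  assumes "g \<in> reps M PP H" "f \<in> borel_measurable M" "\<forall>\<^sub>F x in qs. \<bar>f x\<bar> \<le> \<bar>g x\<bar>"
  shows "f \<in> reps M PP H"
proof -
  note [measurable] = assms(2) repsD(1)[OF assms(1)]
  have "f \<in> reps M PP (orlicz_space M PP \<Phi>)"
    using assms H_orlicz by (intro orlicz_space_solid[of g f]) (auto simp: reps_def)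
  moreover have "L0_le PP (L0_abs M PP (L0_class M PP f)) (L0_abs M PP (L0_class M PP g))"
    using assms(3) by (simp add: class_scale_abs le_class)
  ultimately show ?thesis
    using assms ideal unfolding ideal_in_def by (auto simp: reps_def)
qed

lemma abs_reps: "f \<in> reps M PP H \<Longrightarrow> (\<lambda>x. \<bar>f x\<bar>) \<in> reps M PP H"
  by (rule solid_reps[of f]) (auto dest: repsD(1))

lemma ideal_dedekind_sigma_complete: "dedekind_sigma_complete (L0_le PP) H"
  unfolding dedekind_sigma_complete_def
proof (intro allI impI, elim bexE)
  fix C U assume C: "C \<subseteq> H" "C \<noteq> {}" "countable C" and U: "U \<in> H" "\<forall>Z\<in>C. L0_le PP Z U"
  define c where "c n = from_nat_into C n" for n
  have range_c: "C = range c"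
    using range_from_nat_into[OF C(2,3)] by (simp add: c_def)
  have cH: "c n \<in> H" for n using C(1) range_c by auto
  define u where "u = L0_rep U"
  define r where "r n = L0_rep (c n)" for n
  have meas [measurable]: "u \<in> borel_measurable M" "\<And>n. r n \<in> borel_measurable M"
    using rep_H(2)[OF U(1)] rep_H(2)[OF cH] by (auto simp: u_def r_def)
  have reps: "u \<in> reps M PP H" "\<And>n. r n \<in> reps M PP H"
    using rep_H(1)[OF U(1)] rep_H(1)[OF cH] by (auto simp: u_def r_def)
  have class_r: "L0_class M PP (r n) = c n" for n using class_rep_H[OF cH] by (simp add: r_def)
  \<comment> \<open>The upper bound \<open>u\<close> dominates the \<open>r n\<close> only
    quasi-surely. Cutting at \<open>u\<close> makes the real supremum meaningful at every point and
    changes nothing quasi-surely.\<close>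
  define f where "f x = (SUP n. min (r n x) (u x))" for x
  have bdd: "bdd_above (range (\<lambda>n. min (r n x) (u x)))" for x
    by (rule bdd_aboveI[of _ "u x"]) auto
  have fM [measurable]: "f \<in> borel_measurable M"
    unfolding f_def by (intro borel_measurable_cSUP bdd borel_measurable_min) auto
  have "\<forall>\<^sub>F x in qs. r n x \<le> u x" for n
    using U(2) cH[of n] range_c U(1) le_L0[of "c n" U] H_L0 by (auto simp: r_def u_def)
  then have r_le_u: "\<forall>\<^sub>F x in qs. \<forall>n. r n x \<le> u x" by (simp add: qs_all_countable)
  have f_upper: "min (r n x) (u x) \<le> f x" for n x
    unfolding f_def by (rule cSUP_upper[OF _ bdd]) simp
  have "f x \<le> u x" for x unfolding f_def by (rule cSUP_least) auto
  \<comment> \<open>\<open>f\<close> lies between \<open>min (r 0) u\<close> and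
    \<open>u\<close>.\<close>
  then have "\<bar>f x\<bar> \<le> \<bar>\<bar>r 0 x\<bar> + \<bar>u x\<bar>\<bar>" for x using f_upper[of 0 x] by (smt (verit))
  moreover have "(\<lambda>x. \<bar>r 0 x\<bar> + \<bar>u x\<bar>) \<in> reps M PP H"
    by (intro H_add abs_reps reps)
  ultimately have f: "f \<in> reps M PP H"
    by (intro solid_reps[OF _ fM] always_eventually) blast+
  have "is_lub_in (L0_le PP) H C (L0_class M PP f)"
    unfolding is_lub_in_def
  proof (intro conjI ballI impI)
    show "L0_class M PP f \<in> H" using f by (simp add: reps_def)
    fix Z assume "Z \<in> C"
    then obtain n where n: "Z = L0_class M PP (r n)" using range_c class_r by auto
    have "\<forall>\<^sub>F x in qs. r n x \<le> f x"
      using r_le_u by eventually_elim (metis f_upper min_absorb1)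
    then show "L0_le PP Z (L0_class M PP f)" by (simp add: n le_class)
  next
    fix V assume V: "V \<in> H" "\<forall>Z\<in>C. L0_le PP Z V"
    have "\<forall>\<^sub>F x in qs. r n x \<le> L0_rep V x" for n
      using V cH[of n] range_c le_L0[of "c n" V] H_L0 by (auto simp: r_def)
    then have "\<forall>\<^sub>F x in qs. \<forall>n. r n x \<le> L0_rep V x" by (simp add: qs_all_countable)
    then have "\<forall>\<^sub>F x in qs. f x \<le> L0_rep V x"
    proof eventually_elim
      case (elim x)
      then show ?case unfolding f_def by (intro cSUP_least) (auto intro: min.coboundedI1)
    qed
    then have "L0_le PP (L0_class M PP f) (L0_class M PP (L0_rep V))"
      using rep_H(2)[OF V(1)] by (simp add: le_class)
    then show "L0_le PP (L0_class M PP f) V" by (simp add: class_rep_H[OF V(1)])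
  qed
  then show "\<exists>s. is_lub_in (L0_le PP) H C s" by blast
qed

text \<open>The pointwise infimum represents an element of the ideal by solidity, so it is a lower
  bound in \<open>H\<close> and therefore at most 0. The cut at 0 makes the infimum exist at every
  point, since the \<open>ys n\<close> are nonnegative only quasi-surely.\<close>

lemma decreasing_to_zero:
  fixes ys :: "nat \<Rightarrow> ('a \<Rightarrow> real) set"
  assumes ys: "\<And>n. ys n \<in> H" "\<And>n. L0_le PP (L0_zero M PP) (ys n)"
    and glb: "is_glb_in (L0_le PP) H (range ys) (L0_zero M PP)"
  obtains g where "g \<in> borel_measurable M" "\<forall>\<^sub>F x in qs. g x = 0"
    "\<And>x. g x = (INF n. max 0 (L0_rep (ys n) x))"
proof -
  define r where "r n = L0_rep (ys n)" for n
  have [measurable]: "r n \<in> borel_measurable M" for n using rep_H(2)[OF ys(1)] by (simp add: r_def)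
  define g where "g x = (INF n. max 0 (r n x))" for x
  have bdd: "bdd_below (range (\<lambda>n. max 0 (r n x)))" for x by (rule bdd_belowI[of _ 0]) auto
  have gM [measurable]: "g \<in> borel_measurable M"
    unfolding g_def by (intro borel_measurable_cINF bdd borel_measurable_max) auto
  have g0: "0 \<le> g x" for x unfolding g_def by (rule cINF_greatest) auto
  have g_le: "g x \<le> max 0 (r n x)" for n x unfolding g_def by (rule cINF_lower[OF bdd]) simp
  have "\<bar>g x\<bar> \<le> \<bar>r 0 x\<bar>" for x using g0[of x] g_le[of x 0] by auto
  then have g: "g \<in> reps M PP H"
    using rep_H(1)[OF ys(1)] by (intro solid_reps[of "r 0" g]) (auto simp: r_def)
  have class_r: "L0_class M PP (r n) = ys n" for n using class_rep_H[OF ys(1)] by (simp add: r_def)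
  have "L0_le PP (L0_class M PP g) (ys n)" for n
  proof -
    have "\<forall>\<^sub>F x in qs. 0 \<le> r n x"
      using ys(2)[of n] unfolding L0_zero_def class_r[of n, symmetric] by (subst (asm) le_class) auto
    then have "\<forall>\<^sub>F x in qs. g x \<le> r n x"
      by eventually_elim (metis g_le max_absorb2)
    then show ?thesis unfolding class_r[of n, symmetric] by (subst le_class) auto
  qed
  then have "L0_le PP (L0_class M PP g) (L0_zero M PP)"
    using glb repsD(2)[OF g] unfolding is_glb_in_def by blast
  then have "\<forall>\<^sub>F x in qs. g x \<le> 0" unfolding L0_zero_def by (subst (asm) le_class) auto
  then have "\<forall>\<^sub>F x in qs. g x = 0" by eventually_elim (use g0 in \<open>auto intro: antisym\<close>)
  then show ?thesis using gM by (intro that[of g]) (auto simp: g_def r_def)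
qed

text \<open>On an ideal, integrability of all elements already forces sigma-order continuity, so
  that norm continuity is the only condition left to compare in (2).\<close>

lemma ideal_ca_sigma:
  assumes mu: "\<mu> \<in> ca_of M PP" and int: "\<forall>X\<in>H. integrable (tv M \<mu>) (L0_rep X)"
  shows "\<mu> \<in> ca_sigma M PP H"
proof -
  obtain s where s [measurable]: "s \<in> borel_measurable M"
    and abs_s: "\<And>x. x \<in> space M \<Longrightarrow> \<bar>s x :: real\<bar> = 1"
    and sint_s: "\<And>X. integrable (tv M \<mu>) (L0_rep X) \<Longrightarrow> sint M \<mu> X = (\<integral>x. s x * L0_rep X x \<partial>tv M \<mu>)"
    using sint_eq_integral_tv[of \<mu> M] mu unfolding ca_of_def by blast
  have sint_H: "sint M \<mu> X = (\<integral>x. s x * L0_rep X x \<partial>tv M \<mu>)" if "X \<in> H" for X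
    using sint_s int that by blast
  have meas [measurable]: "L0_rep X \<in> borel_measurable M" if "X \<in> H" for X by (rule rep_H(2)[OF that])
  have int_s: "integrable (tv M \<mu>) (\<lambda>x. s x * L0_rep X x)" if "X \<in> H" for X
    using int that s abs_s by (intro integrable_sign_mult) simp_all
  have add: "L0_add M PP X Y \<in> H" and scale: "L0_scale M PP c X \<in> H" if "X \<in> H" "Y \<in> H" for X Y c
    using H_subspace that by (auto simp: L0_subspace_def)
  have "linear_functional_on M PP H (sint M \<mu>)"
    unfolding linear_functional_on_def
  proof (intro conjI ballI allI)
    fix X Y assume XY: "X \<in> H" "Y \<in> H"
    note [measurable] = meas[OF XY(1)] meas[OF XY(2)] meas[OF add[OF XY]]
    have "sint M \<mu> (L0_add M PP X Y) = (\<integral>x. s x * L0_rep X x + s x * L0_rep Y x \<partial>tv M \<mu>)"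
      unfolding sint_H[OF add[OF XY]]
    proof (intro integral_cong_ca_of mu)
      have "\<forall>\<^sub>F x in qs. L0_rep (L0_add M PP X Y) x = L0_rep X x + L0_rep Y x"
        using XY H_L0 by (intro rep_arith) auto
      then show "\<forall>\<^sub>F x in qs. s x * L0_rep (L0_add M PP X Y) x = s x * L0_rep X x + s x * L0_rep Y x"
        by eventually_elim (simp add: distrib_left)
    qed measurable
    also have "\<dots> = sint M \<mu> X + sint M \<mu> Y"
      using XY by (simp add: sint_H int_s)
    finally show "sint M \<mu> (L0_add M PP X Y) = sint M \<mu> X + sint M \<mu> Y" .
  next
    fix c X assume X: "X \<in> H"
    note [measurable] = meas[OF X] meas[OF scale[OF X X]]
    have "sint M \<mu> (L0_scale M PP c X) = (\<integral>x. c * (s x * L0_rep X x) \<partial>tv M \<mu>)"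
      unfolding sint_H[OF scale[OF X X]]
    proof (intro integral_cong_ca_of mu)
      have "\<forall>\<^sub>F x in qs. L0_rep (L0_scale M PP c X) x = c * L0_rep X x"
        using X H_L0 by (intro rep_arith) auto
      then show "\<forall>\<^sub>F x in qs. s x * L0_rep (L0_scale M PP c X) x = c * (s x * L0_rep X x)"
        by eventually_elim simp
    qed measurable
    then show "sint M \<mu> (L0_scale M PP c X) = c * sint M \<mu> X" using X by (simp add: sint_H)
  qed
  moreover have "sigma_order_continuous M PP H (sint M \<mu>)"
    unfolding sigma_order_continuous_def
  proof (intro conjI ballI allI impI)
    fix X Y assume XY: "X \<in> H" "Y \<in> H"
    note [measurable] = meas[OF XY(1)] meas[OF XY(2)]
    define B where "B = (\<integral>x. \<bar>L0_rep X x\<bar> + \<bar>L0_rep Y x\<bar> \<partial>tv M \<mu>)"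
    have "\<bar>sint M \<mu> Z\<bar> \<le> B" if Z: "Z \<in> H" "L0_le PP X Z" "L0_le PP Z Y" for Z
    proof -
      note [measurable] = meas[OF Z(1)]
      have "\<forall>\<^sub>F x in qs. L0_rep X x \<le> L0_rep Z x" "\<forall>\<^sub>F x in qs. L0_rep Z x \<le> L0_rep Y x"
        using Z XY H_L0 le_L0 by blast+
      then have "\<forall>\<^sub>F x in qs. \<bar>s x * L0_rep Z x\<bar> \<le> \<bar>L0_rep X x\<bar> + \<bar>L0_rep Y x\<bar>"
        using qs_space by eventually_elim (simp add: abs_mult abs_s)
      then have "AE x in tv M \<mu>. \<bar>s x * L0_rep Z x\<bar> \<le> \<bar>L0_rep X x\<bar> + \<bar>L0_rep Y x\<bar>"
        by (intro AE_ca_of[OF mu]) measurable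
      then have "(\<integral>x. \<bar>s x * L0_rep Z x\<bar> \<partial>tv M \<mu>) \<le> B"
        unfolding B_def using int XY Z int_s by (intro integral_mono_AE) auto
      then show ?thesis
        unfolding sint_H[OF Z(1)]
        using integral_abs_bound[of "tv M \<mu>" "\<lambda>x. s x * L0_rep Z x"] by linarith
    qed
    then show "bounded {sint M \<mu> Z |Z. Z \<in> H \<and> L0_le PP X Z \<and> L0_le PP Z Y}"
      by (auto simp: bounded_iff)
  next
    fix xs assume xs: "\<forall>n. xs n \<in> H" and
      "\<exists>ys. (\<forall>n. ys n \<in> H \<and> L0_le PP (L0_zero M PP) (ys n)) \<and>
         (\<forall>n. L0_le PP (L0_abs M PP (xs n)) (ys n)) \<and>
         (\<forall>n. L0_le PP (ys (Suc n)) (ys n)) \<and> is_glb_in (L0_le PP) H (range ys) (L0_zero M PP)"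
    then obtain ys where ys: "\<And>n. ys n \<in> H" "\<And>n. L0_le PP (L0_zero M PP) (ys n)"
      "\<And>n. L0_le PP (L0_abs M PP (xs n)) (ys n)" "\<And>n. L0_le PP (ys (Suc n)) (ys n)"
      "is_glb_in (L0_le PP) H (range ys) (L0_zero M PP)" by blast
    define x where "x n = L0_rep (xs n)" for n
    define y where "y n = L0_rep (ys n)" for n
    have [measurable]: "x n \<in> borel_measurable M" "y n \<in> borel_measurable M" for n
      using meas xs ys(1) by (auto simp: x_def y_def)
    have cl: "xs n = L0_class M PP (x n)" "ys n = L0_class M PP (y n)" for n
      using class_rep_H xs ys(1) by (auto simp: x_def y_def)
    obtain g where [measurable]: "g \<in> borel_measurable M" and g0: "\<forall>\<^sub>F t in qs. g t = 0"
      and g: "\<And>t. g t = (INF n. max 0 (y n t))"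
      using decreasing_to_zero[of ys] ys unfolding y_def by blast
    have ae_g: "AE t in tv M \<mu>. g t = 0" by (rule AE_ca_of[OF mu _ g0]) measurable
    have "\<forall>\<^sub>F t in qs. 0 \<le> y n t \<and> \<bar>x n t\<bar> \<le> y n t \<and> y (Suc n) t \<le> y n t" for n
    proof (intro eventually_conj)
      show "\<forall>\<^sub>F t in qs. 0 \<le> y n t" using ys(2)[of n] by (simp add: L0_zero_def cl le_class)
      show "\<forall>\<^sub>F t in qs. \<bar>x n t\<bar> \<le> y n t" using ys(3)[of n] by (simp add: class_scale_abs cl le_class)
      show "\<forall>\<^sub>F t in qs. y (Suc n) t \<le> y n t" using ys(4)[of n] by (simp add: cl le_class)
    qed
    then have "AE t in tv M \<mu>. 0 \<le> y n t \<and> \<bar>x n t\<bar> \<le> y n t \<and> y (Suc n) t \<le> y n t" for n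
      by (intro AE_ca_of[OF mu]) measurable
    then have ae: "AE t in tv M \<mu>. \<forall>n. 0 \<le> y n t \<and> \<bar>x n t\<bar> \<le> y n t \<and> y (Suc n) t \<le> y n t"
      by (simp add: AE_all_countable)
    \<comment> \<open>The first majorant \<open>y 0\<close> bounds the whole sequence, because the
      \<open>y n\<close> decrease.\<close>
    have "(\<lambda>n. \<integral>t. s t * x n t \<partial>tv M \<mu>) \<longlonglongrightarrow> (\<integral>t. 0 \<partial>tv M \<mu>)"
    proof (rule integral_dominated_convergence)
      show "integrable (tv M \<mu>) (y 0)" using int ys(1) by (simp add: y_def)
      show "AE t in tv M \<mu>. (\<lambda>n. s t * x n t) \<longlonglongrightarrow> 0"
        using ae ae_g AE_space
      proof eventually_elim
        case (elim t)
        have dec: "decseq (\<lambda>n. y n t)" using elim(1) by (intro decseq_SucI) auto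
        \<comment> \<open>At such points the cut at 0 is inactive, so \<open>g t\<close> is the true
          infimum of the decreasing sequence \<open>y n t\<close>, hence its limit.\<close>
        have "max 0 (y n t) = y n t" for n using elim(1) by (simp add: max_absorb2)
        moreover have "(\<lambda>n. y n t) \<longlonglongrightarrow> (INF n. y n t)"
          using elim(1) by (intro LIMSEQ_decseq_INF dec bdd_belowI[of _ 0]) auto
        ultimately have "(\<lambda>n. y n t) \<longlonglongrightarrow> 0" using elim(2) g[of t] by simp
        then show ?case
          by (rule Lim_null_comparison[rotated]) (use elim abs_s in \<open>auto simp: abs_mult\<close>)
      qed
      show "AE t in tv M \<mu>. norm (s t * x n t) \<le> y 0 t" for n
        using ae AE_space
      proof eventually_elim
        case (elim t)
        have "decseq (\<lambda>n. y n t)" using elim(1) by (intro decseq_SucI) auto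
        then have "y n t \<le> y 0 t" by (simp add: decseq_def)
        moreover have "\<bar>x n t\<bar> \<le> y n t" using elim(1) by blast
        ultimately show ?case using elim(2) abs_s by (simp add: abs_mult)
      qed
    qed measurable
    then show "(\<lambda>n. \<bar>sint M \<mu> (xs n)\<bar>) \<longlonglongrightarrow> 0"
      using xs by (intro tendsto_rabs_zero) (simp add: sint_H x_def)
  qed
  ultimately show ?thesis using mu int by (simp add: ca_sigma_def)
qed

text \<open>With \<open>s\<close> the sign of the Hahn decomposition of \<open>\<mu>\<close>, multiplication by \<open>s\<close> preserves both the
  ideal and the norm, and it exchanges the functionals of \<open>\<mu>\<close> and \<open>|\<mu>|\<close>.\<close>

lemma ideal_norm_continuous_iff:
  assumes mu: "\<mu> \<in> ca_of M PP" and int: "\<forall>X\<in>H. integrable (tv M \<mu>) (L0_rep X)"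
  shows "norm_continuous_on M PP \<Phi> H (\<lambda>X. \<integral>x. L0_rep X x \<partial>tv M \<mu>) \<longleftrightarrow>
    norm_continuous_on M PP \<Phi> H (sint M \<mu>)"
proof -
  obtain s where s [measurable]: "s \<in> borel_measurable M"
    and abs_s: "\<And>x. x \<in> space M \<Longrightarrow> \<bar>s x :: real\<bar> = 1"
    and sint_s: "\<And>X. integrable (tv M \<mu>) (L0_rep X) \<Longrightarrow> sint M \<mu> X = (\<integral>x. s x * L0_rep X x \<partial>tv M \<mu>)"
    using sint_eq_integral_tv[of \<mu> M] mu unfolding ca_of_def by blast
  have ss: "s x * (s x * w) = w" if "x \<in> space M" for x w
  proof -
    have "s x * s x = 1" using abs_s[OF that] by (metis abs_mult_self_eq mult_1)
    then show ?thesis by (simp add: mult.assoc[symmetric])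
  qed
  \<comment> \<open>The two directions are the instances \<open>h = 1, k = s\<close> and
    \<open>h = s, k = 1\<close>; the second uses that \<open>s\<close> squares to 1.\<close>
  have transfer: "norm_continuous_on M PP \<Phi> H (\<lambda>X. \<integral>x. k x * L0_rep X x \<partial>tv M \<mu>)"
    if cont: "norm_continuous_on M PP \<Phi> H (\<lambda>X. \<integral>x. h x * L0_rep X x \<partial>tv M \<mu>)"
      and [measurable]: "h \<in> borel_measurable M" "k \<in> borel_measurable M"
      and k1: "\<And>x. x \<in> space M \<Longrightarrow> \<bar>k x\<bar> = 1"
      and hk: "\<And>x w. x \<in> space M \<Longrightarrow> h x * (s x * w) = k x * w" for h k
    unfolding norm_continuous_on_def
  proof (intro ballI allI impI)
    fix X and e :: real assume X: "X \<in> H" and e: "0 < e"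
    have zero: "L0_zero M PP \<in> H" using repsD(2)[OF zero_reps] by (simp add: L0_zero_def)
    obtain d where d: "0 < d" "\<And>Z. Z \<in> H \<Longrightarrow>
        orlicz_norm PP \<Phi> (L0_diff M PP Z (L0_zero M PP)) < ennreal d \<Longrightarrow>
        \<bar>(\<integral>x. h x * L0_rep Z x \<partial>tv M \<mu>) - (\<integral>x. h x * L0_rep (L0_zero M PP) x \<partial>tv M \<mu>)\<bar> < e"
      using cont zero e unfolding norm_continuous_on_def by meson
    have "\<bar>(\<integral>x. k x * L0_rep Y x \<partial>tv M \<mu>) - (\<integral>x. k x * L0_rep X x \<partial>tv M \<mu>)\<bar> < e"
      if Y: "Y \<in> H" and less: "orlicz_norm PP \<Phi> (L0_diff M PP Y X) < ennreal d" for Y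
    proof -
      note [measurable] = rep_H(2)[OF X] rep_H(2)[OF Y]
      define w where "w x = L0_rep Y x - L0_rep X x" for x
      have w: "w \<in> reps M PP H" unfolding w_def by (intro H_diff rep_H X Y)
      note [measurable] = repsD(1)[OF w]
      have abs_sw: "\<forall>\<^sub>F x in qs. \<bar>s x * w x\<bar> = \<bar>w x\<bar>"
        using qs_space by eventually_elim (simp add: abs_mult abs_s)
      \<comment> \<open>The \<open>h\<close>-integral of \<open>Z\<close> is the
        \<open>k\<close>-integral of \<open>Y - X\<close>, while \<open>Z\<close> and
        \<open>Y - X\<close> have the same norm. Continuity of the given functional is therefore
        used at 0.\<close>
      define Z where "Z = L0_class M PP (\<lambda>x. s x * w x)"
      have "(\<lambda>x. s x * w x) \<in> reps M PP H"
        by (rule solid_reps[OF w]) (use abs_sw in \<open>auto elim: eventually_mono\<close>)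
      then have Z: "Z \<in> H" by (simp add: Z_def reps_def)
      note [measurable] = rep_H(2)[OF Z] rep_H(2)[OF zero]
      have "orlicz_norm PP \<Phi> (L0_diff M PP Z (L0_zero M PP)) = orlicz_norm PP \<Phi> (L0_class M PP w)"
        using abs_sw by (simp add: Z_def L0_zero_def class_arith orlicz_norm_cong)
      also have "L0_class M PP w = L0_diff M PP Y X" by (simp add: L0_diff_def w_def[abs_def])
      finally have "\<bar>(\<integral>x. h x * L0_rep Z x \<partial>tv M \<mu>) - (\<integral>x. h x * L0_rep (L0_zero M PP) x \<partial>tv M \<mu>)\<bar> < e"
        using d(2)[OF Z] less by simp
      moreover have "(\<integral>x. h x * L0_rep (L0_zero M PP) x \<partial>tv M \<mu>) = (\<integral>x. 0 \<partial>tv M \<mu>)"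
        using rep_class(2)[of "\<lambda>x. 0"]
        by (intro integral_cong_ca_of mu) (auto simp: L0_zero_def elim: eventually_mono
            intro!: borel_measurable_times rep_class(1))
      moreover have "(\<integral>x. h x * L0_rep Z x \<partial>tv M \<mu>) = (\<integral>x. k x * L0_rep Y x - k x * L0_rep X x \<partial>tv M \<mu>)"
      proof (intro integral_cong_ca_of mu)
        have "\<forall>\<^sub>F x in qs. L0_rep Z x = s x * w x" unfolding Z_def by (rule rep_class) measurable
        with qs_space show "\<forall>\<^sub>F x in qs. h x * L0_rep Z x = k x * L0_rep Y x - k x * L0_rep X x"
          by eventually_elim (simp add: hk w_def right_diff_distrib)
      qed measurable
      moreover have "integrable (tv M \<mu>) (\<lambda>x. k x * L0_rep V x)" if "V \<in> H" for V
        using int that k1 by (intro integrable_sign_mult) simp_all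
      ultimately show ?thesis using X Y by simp
    qed
    then show "\<exists>d>0. \<forall>Y\<in>H. orlicz_norm PP \<Phi> (L0_diff M PP Y X) < ennreal d \<longrightarrow>
        \<bar>(\<integral>x. k x * L0_rep Y x \<partial>tv M \<mu>) - (\<integral>x. k x * L0_rep X x \<partial>tv M \<mu>)\<bar> < e"
      using d(1) by blast
  qed
  have "norm_continuous_on M PP \<Phi> H (sint M \<mu>) \<longleftrightarrow>
      norm_continuous_on M PP \<Phi> H (\<lambda>X. \<integral>x. s x * L0_rep X x \<partial>tv M \<mu>)"
    unfolding norm_continuous_on_def using int sint_s by (simp cong: ball_cong)
  moreover have "norm_continuous_on M PP \<Phi> H (\<lambda>X. \<integral>x. s x * L0_rep X x \<partial>tv M \<mu>)"
    if "norm_continuous_on M PP \<Phi> H (\<lambda>X. \<integral>x. 1 * L0_rep X x \<partial>tv M \<mu>)"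
    by (rule transfer[OF that]) (simp_all add: abs_s)
  moreover have "norm_continuous_on M PP \<Phi> H (\<lambda>X. \<integral>x. 1 * L0_rep X x \<partial>tv M \<mu>)"
    if "norm_continuous_on M PP \<Phi> H (\<lambda>X. \<integral>x. s x * L0_rep X x \<partial>tv M \<mu>)"
    by (rule transfer[OF that]) (simp_all add: ss)
  ultimately show ?thesis by auto
qed

lemma ideal_ca_H:
  "ca_H M PP \<Phi> H = {\<mu> \<in> ca_sigma M PP H. sint M \<mu> \<in> norm_dual M PP \<Phi> H}"
proof -
  have "\<mu> \<in> ca_H M PP \<Phi> H \<longleftrightarrow> \<mu> \<in> ca_sigma M PP H \<and> sint M \<mu> \<in> norm_dual M PP \<Phi> H" for \<mu>
    using ideal_ca_sigma[of \<mu>] ideal_norm_continuous_iff[of \<mu>]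
    by (auto simp: ca_H_def ca_sigma_def norm_dual_def)
  then show ?thesis by blast
qed

end

section \<open>Order complete sublattices\<close>

text \<open>\<open>dom\<close> is the direction of the equivalence in (1) that produces information
  about \<open>PP\<close>: a set null for all positive sigma-order continuous measures is null for
  every P.\<close>

locale order_complete_sublattice = orlicz_subspace +
  assumes lattice: "X \<in> H \<Longrightarrow> Y \<in> H \<Longrightarrow> L0_sup M PP X Y \<in> H \<and> L0_inf M PP X Y \<in> H"
    and one: "L0_one M PP \<in> H"
    and gen: "generates M PP H"
    and complete: "dedekind_sigma_complete (L0_le PP) H"
    and dom: "dominated M (measure ` PP) (ca_sigma_plus M PP H)"
begin

lemma max_min_reps:
  assumes "f \<in> reps M PP H" "g \<in> reps M PP H"
  shows "(\<lambda>x. max (f x) (g x)) \<in> reps M PP H" "(\<lambda>x. min (f x) (g x)) \<in> reps M PP H"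
  using lattice[OF repsD(2)[OF assms(1)] repsD(2)[OF assms(2)]] repsD(1)[OF assms(1)] repsD(1)[OF assms(2)]
  by (auto simp: class_arith reps_def)

lemma const_reps: "(\<lambda>x. c) \<in> reps M PP H"
proof -
  have "(indicator (space M) :: 'a \<Rightarrow> real) \<in> reps M PP H"
    using one by (simp add: reps_def L0_one_def)
  from H_scale[OF this, of c] show ?thesis
    by (rule reps_cong) (auto intro: eventually_mono[OF qs_space])
qed

text \<open>A supremum \<open>\<sigma>\<close> taken in \<open>H\<close> could a priori exceed the pointwise one; order continuity of the
  functionals in \<open>ca_sigma_plus\<close> rules this out almost surely for each of them, hence quasi-surely.\<close>

lemma monotone_limit_reps:
  fixes x :: "nat \<Rightarrow> 'a \<Rightarrow> real"
  assumes x: "\<And>n. x n \<in> reps M PP H" "\<And>n. \<forall>\<^sub>F t in qs. x n t \<le> x (Suc n) t"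
    and u: "u \<in> reps M PP H" "\<forall>\<^sub>F t in qs. f t \<le> u t"
    and fM [measurable]: "f \<in> borel_measurable M"
    and lim: "\<forall>\<^sub>F t in qs. (\<lambda>n. x n t) \<longlonglongrightarrow> f t"
  shows "f \<in> reps M PP H"
proof -
  have [measurable]: "x n \<in> borel_measurable M" "u \<in> borel_measurable M" for n
    using x(1) u(1) by (auto dest: repsD)
  have "\<forall>\<^sub>F t in qs. \<forall>n. x n t \<le> x (Suc n) t" using x(2) by (simp add: qs_all_countable)
  then have x_le_f: "\<forall>\<^sub>F t in qs. \<forall>n. x n t \<le> f t"
    using lim
  proof eventually_elim
    case (elim t)
    then have "incseq (\<lambda>n. x n t)" by (intro incseq_SucI) auto
    then show ?case using incseq_le elim(2) by blast
  qed
  define C where "C = range (\<lambda>n. L0_class M PP (x n))"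
  have "\<exists>U\<in>H. \<forall>c\<in>C. L0_le PP c U"
  proof
    show "\<forall>c\<in>C. L0_le PP c (L0_class M PP u)"
    proof
      fix c assume "c \<in> C"
      then obtain n where n: "c = L0_class M PP (x n)" by (auto simp: C_def)
      have "\<forall>\<^sub>F t in qs. x n t \<le> u t"
        using x_le_f u(2) by eventually_elim (metis order_trans)
      then show "L0_le PP c (L0_class M PP u)" by (simp add: n le_class)
    qed
  qed (use u(1) in \<open>simp add: reps_def\<close>)
  moreover have "C \<subseteq> H" "C \<noteq> {}" "countable C" using x(1) by (auto simp: C_def reps_def)
  ultimately obtain S where S: "is_lub_in (L0_le PP) H C S"
    using complete unfolding dedekind_sigma_complete_def by blast
  then have S_H: "S \<in> H" by (simp add: is_lub_in_def)
  define \<sigma> where "\<sigma> = L0_rep S"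
  have \<sigma>: "\<sigma> \<in> reps M PP H" using rep_H(1)[OF S_H] by (simp add: \<sigma>_def)
  note [measurable] = repsD(1)[OF \<sigma>]
  have class_\<sigma>: "L0_class M PP \<sigma> = S" using class_rep_H[OF S_H] by (simp add: \<sigma>_def)
  have x_le_\<sigma>: "\<forall>\<^sub>F t in qs. x n t \<le> \<sigma> t" for n
  proof -
    have "L0_le PP (L0_class M PP (x n)) (L0_class M PP \<sigma>)"
      using S class_\<sigma> by (auto simp: is_lub_in_def C_def)
    then show ?thesis by (simp add: le_class)
  qed
  have least: "\<forall>\<^sub>F t in qs. \<sigma> t \<le> v t" if v: "v \<in> reps M PP H" "\<And>n. \<forall>\<^sub>F t in qs. x n t \<le> v t" for v
  proof -
    note [measurable] = repsD(1)[OF v(1)]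
    have "\<forall>c\<in>C. L0_le PP c (L0_class M PP v)" using v(2) by (auto simp: C_def le_class)
    then have "L0_le PP (L0_class M PP \<sigma>) (L0_class M PP v)"
      using S repsD(2)[OF v(1)] class_\<sigma> by (auto simp: is_lub_in_def)
    then show ?thesis by (simp add: le_class)
  qed
  have f_le_\<sigma>: "\<forall>\<^sub>F t in qs. f t \<le> \<sigma> t"
  proof -
    have "\<forall>\<^sub>F t in qs. \<forall>n. x n t \<le> \<sigma> t" using x_le_\<sigma> by (simp add: qs_all_countable)
    then show ?thesis using lim by eventually_elim (auto intro: LIMSEQ_le_const2)
  qed
  \<comment> \<open>The distances to the supremum act both as the test sequence and as its own
    decreasing majorant.\<close>
  define y where "y n t = \<sigma> t - x n t" for n t
  have y: "y n \<in> reps M PP H" for n unfolding y_def by (intro H_diff \<sigma> x(1))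
  have [measurable]: "y n \<in> borel_measurable M" for n using y by (rule repsD)
  define ys where "ys n = L0_class M PP (y n)" for n
  have ys_H: "ys n \<in> H" for n using y by (simp add: ys_def reps_def)
  have ys_pos: "L0_le PP (L0_zero M PP) (ys n)" for n
    unfolding L0_zero_def ys_def using x_le_\<sigma>[of n] by (simp add: le_class y_def)
  have ys_abs: "L0_le PP (L0_abs M PP (ys n)) (ys n)" for n
    unfolding ys_def using x_le_\<sigma>[of n]
    by (auto simp: class_scale_abs le_class y_def elim: eventually_mono)
  have ys_dec: "L0_le PP (ys (Suc n)) (ys n)" for n
    unfolding ys_def using x(2)[of n] by (simp add: le_class y_def)
  have ys_glb: "is_glb_in (L0_le PP) H (range ys) (L0_zero M PP)"
    unfolding is_glb_in_def
  proof (intro conjI ballI impI)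
    show "L0_zero M PP \<in> H" using repsD(2)[OF zero_reps] by (simp add: L0_zero_def)
    show "L0_le PP (L0_zero M PP) c" if "c \<in> range ys" for c using that ys_pos by auto
    fix V assume V: "V \<in> H" "\<forall>c\<in>range ys. L0_le PP V c"
    note [measurable] = rep_H(2)[OF V(1)]
    \<comment> \<open>If \<open>V\<close> lies below every \<open>\<sigma> - x n\<close>, then
      \<open>\<sigma> - V\<close> is an upper bound of the sequence in \<open>H\<close>, so
      leastness of \<open>\<sigma>\<close> gives \<open>V\<close> \<le> 0.\<close>
    have "\<forall>\<^sub>F t in qs. x n t \<le> \<sigma> t - L0_rep V t" for n
    proof -
      have "L0_le PP (L0_class M PP (L0_rep V)) (ys n)" using V by (simp add: class_rep_H)
      then have "\<forall>\<^sub>F t in qs. L0_rep V t \<le> y n t" by (simp add: ys_def le_class)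
      then show ?thesis by eventually_elim (simp add: y_def)
    qed
    then have "\<forall>\<^sub>F t in qs. \<sigma> t \<le> \<sigma> t - L0_rep V t"
      by (intro least H_diff \<sigma> rep_H V)
    then have "\<forall>\<^sub>F t in qs. L0_rep V t \<le> 0" by eventually_elim simp
    then have "L0_le PP (L0_class M PP (L0_rep V)) (L0_zero M PP)"
      by (simp add: L0_zero_def le_class)
    then show "L0_le PP V (L0_zero M PP)" by (simp add: class_rep_H[OF V(1)])
  qed
  define N where "N = {t \<in> space M. \<not> \<sigma> t \<le> f t}"
  have N: "N \<in> sets M" unfolding N_def by measurable
  have "emeasure (tv M \<mu>) N = 0" if mu: "\<mu> \<in> ca_sigma_plus M PP H" for \<mu>
  proof -
    have mu': "\<mu> \<in> ca_of M PP" "\<forall>X\<in>H. integrable (tv M \<mu>) (L0_rep X)" "\<mu> \<in> ca_plus M"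
      "sigma_order_continuous M PP H (sint M \<mu>)"
      using mu unfolding ca_sigma_plus_def ca_sigma_def by blast+
    have "(\<lambda>n. \<bar>sint M \<mu> (ys n)\<bar>) \<longlonglongrightarrow> 0"
      by (rule mu'(4)[unfolded sigma_order_continuous_def, THEN conjunct2, rule_format])
        (auto intro!: exI[of _ ys] simp: ys_H ys_pos ys_abs ys_dec ys_glb)
    moreover have "sint M \<mu> (ys n) = (\<integral>t. y n t \<partial>tv M \<mu>)" for n
      unfolding sint_ca_plus[OF mu'(3)] ys_def
      by (rule integral_cong_ca_of(1)[OF mu'(1) rep_class(1) _ rep_class(2)]) simp_all
    ultimately have "(\<lambda>n. \<integral>t. y n t \<partial>tv M \<mu>) \<longlonglongrightarrow> 0"
      by (simp add: tendsto_rabs_zero_iff)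
    then have "(\<lambda>n. ennreal (\<integral>t. y n t \<partial>tv M \<mu>)) \<longlonglongrightarrow> ennreal 0"
      by (rule tendsto_ennrealI)
    \<comment> \<open>As \<open>x n\<close> \<le> \<open>f\<close>, the gap
      \<open>\<sigma> - f\<close> lies below every \<open>y n\<close>, whose integrals tend to
      0.\<close>
    moreover have "(\<integral>\<^sup>+t. ennreal (\<sigma> t - f t) \<partial>tv M \<mu>) \<le> ennreal (\<integral>t. y n t \<partial>tv M \<mu>)" for n
    proof -
      have "\<forall>\<^sub>F t in qs. ennreal (\<sigma> t - f t) \<le> ennreal (y n t)"
        using x_le_f by eventually_elim (auto simp: y_def intro!: ennreal_leI)
      then have "AE t in tv M \<mu>. ennreal (\<sigma> t - f t) \<le> ennreal (y n t)"
        by (intro AE_ca_of[OF mu'(1)]) measurable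
      then have "(\<integral>\<^sup>+t. ennreal (\<sigma> t - f t) \<partial>tv M \<mu>) \<le> (\<integral>\<^sup>+t. ennreal (y n t) \<partial>tv M \<mu>)"
        by (rule nn_integral_mono_AE)
      also have "\<dots> = ennreal (\<integral>t. y n t \<partial>tv M \<mu>)"
      proof (rule nn_integral_eq_integral)
        show "integrable (tv M \<mu>) (y n)" by (rule integrable_reps[OF mu'(1,2) y])
        show "AE t in tv M \<mu>. 0 \<le> y n t"
          by (rule AE_ca_of[OF mu'(1)]) (use x_le_\<sigma>[of n] in \<open>auto simp: y_def\<close>)
      qed
      finally show ?thesis .
    qed
    ultimately have "(\<integral>\<^sup>+t. ennreal (\<sigma> t - f t) \<partial>tv M \<mu>) \<le> ennreal 0"
      by (intro LIMSEQ_le_const) auto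
    then have "AE t in tv M \<mu>. ennreal (\<sigma> t - f t) = 0"
      by (simp add: nn_integral_0_iff_AE)
    then have "AE t in tv M \<mu>. \<sigma> t \<le> f t"
      by eventually_elim (simp add: ennreal_eq_0_iff)
    then show ?thesis
      using N by (subst (asm) AE_iff_measurable) (auto simp: N_def)
  qed
  then have "(SUP \<mu>\<in>ca_sigma_plus M PP H. emeasure (tv M \<mu>) N) = 0"
    by (intro antisym SUP_least) auto
  then have sup0: "(SUP \<mu>\<in>measure ` PP. emeasure (tv M \<mu>) N) = 0"
    using dom N by (simp add: dominated_def)
  have "emeasure P N = 0" if P: "P \<in> PP" for P
  proof -
    have "emeasure (tv M (measure P)) N \<le> (SUP \<mu>\<in>measure ` PP. emeasure (tv M \<mu>) N)"
      by (rule SUP_upper) (rule imageI[OF P])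
    then show ?thesis unfolding sup0 measure_in_ca_of(2)[OF P] by simp
  qed
  then have "\<forall>\<^sub>F t in qs. \<sigma> t \<le> f t"
    unfolding eventually_qs using N
    by (auto simp: N_def space_PP sets_PP intro!: AE_I[where N = N])
  with f_le_\<sigma> have "\<forall>\<^sub>F t in qs. \<sigma> t = f t" by eventually_elim simp
  then show ?thesis by (rule reps_cong[OF \<sigma> fM])
qed

section \<open>The sigma-algebra of sets whose indicators represent elements of
  \<open>H\<close>\<close>

lemma indicator_compl_reps:
  assumes "indicator A \<in> reps M PP H"
  shows "(indicator (space M - A) :: 'a \<Rightarrow> real) \<in> reps M PP H"
proof (rule reps_cong)
  have [measurable]: "(indicator A :: 'a \<Rightarrow> real) \<in> borel_measurable M" by (rule repsD(1)[OF assms])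
  show "(\<lambda>x. 1 - indicator A x) \<in> reps M PP H" by (intro H_diff const_reps assms)
  have "(\<lambda>x. indicator (space M) x * (1 - indicator A x) :: real) \<in> borel_measurable M" by measurable
  also have "(\<lambda>x. indicator (space M) x * (1 - indicator A x) :: real) = indicator (space M - A)"
    by (auto simp: indicator_def)
  finally show "(indicator (space M - A) :: 'a \<Rightarrow> real) \<in> borel_measurable M" .
  show "\<forall>\<^sub>F x in qs. 1 - indicator A x = (indicator (space M - A) x :: real)"
    using qs_space by eventually_elim (auto simp: indicator_def)
qed

lemma indicator_UN_reps:
  fixes A :: "nat \<Rightarrow> 'a set"
  assumes "\<And>i. indicator (A i) \<in> reps M PP H"
  shows "(indicator (\<Union>i. A i) :: 'a \<Rightarrow> real) \<in> reps M PP H"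
proof (rule monotone_limit_reps)
  show fin: "(indicator (\<Union>i<n. A i) :: 'a \<Rightarrow> real) \<in> reps M PP H" for n
  proof (induction n)
    case 0
    show ?case using const_reps[of 0] by (simp add: indicator_def[abs_def])
  next
    case (Suc n)
    have "(\<lambda>x. max (indicator (A n) x) (indicator (\<Union>i<n. A i) x) :: real) = indicator (\<Union>i<Suc n. A i)"
      by (auto simp: lessThan_Suc indicator_def fun_eq_iff)
    then show ?case using max_min_reps(1)[OF assms[of n] Suc] by simp
  qed
  have lim: "(\<lambda>n. indicator (\<Union>i<n. A i) x :: real) \<longlonglongrightarrow> indicator (\<Union>i. A i) x" for x
    by (rule LIMSEQ_indicator_UN)
  then show "\<forall>\<^sub>F x in qs. (\<lambda>n. indicator (\<Union>i<n. A i) x :: real) \<longlonglongrightarrow> indicator (\<Union>i. A i) x"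
    by simp
  show "(indicator (\<Union>i. A i) :: 'a \<Rightarrow> real) \<in> borel_measurable M"
    by (rule borel_measurable_LIMSEQ_real[OF lim]) (rule repsD(1)[OF fin])
  show "\<forall>\<^sub>F x in qs. (indicator (\<Union>i<n. A i) x :: real) \<le> indicator (\<Union>i<Suc n. A i) x" for n
    by (intro always_eventually allI) (auto simp: indicator_def)
  show "(\<lambda>x. 1) \<in> reps M PP H" by (rule const_reps)
  show "\<forall>\<^sub>F x in qs. (indicator (\<Union>i. A i) x :: real) \<le> 1"
    by (intro always_eventually allI) (auto simp: indicator_def)
qed

text \<open>The functions \<open>min 1 (n * max 0 (f - c))\<close> use only constants, linear and
  lattice operations, and they increase to the indicator of \<open>f > c\<close>. They reach 1 at a
  point with \<open>f > c\<close> as soon as \<open>n\<close> \<ge> 1/(f - c).\<close>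

lemma indicator_greater_reps:
  assumes f: "f \<in> reps M PP H"
  shows "(indicator (f -` {c<..} \<inter> space M) :: 'a \<Rightarrow> real) \<in> reps M PP H"
proof (rule monotone_limit_reps)
  note [measurable] = repsD(1)[OF f]
  define x where "x n t = min 1 (real n * max 0 (f t - c))" for n t
  show "x n \<in> reps M PP H" for n
    unfolding x_def
    by (intro max_min_reps H_scale H_diff const_reps f)
  show "\<forall>\<^sub>F t in qs. x n t \<le> x (Suc n) t" for n
    unfolding x_def by (intro always_eventually allI min.mono mult_right_mono) auto
  show "\<forall>\<^sub>F t in qs. (\<lambda>n. x n t) \<longlonglongrightarrow> indicator (f -` {c<..} \<inter> space M) t"
    using qs_space
  proof eventually_elim
    case (elim t)
    show ?case
    proof (cases "c < f t")
      case True
      have "\<forall>\<^sub>F n in sequentially. 1 / (f t - c) \<le> real n"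
        by (rule eventually_compose_filterlim[OF eventually_ge_at_top filterlim_real_sequentially])
      then have "\<forall>\<^sub>F n in sequentially. x n t = 1"
        by eventually_elim (use True in \<open>simp add: x_def field_simps\<close>)
      then show ?thesis using True elim by (simp add: tendsto_eventually)
    next
      case False
      then show ?thesis by (simp add: x_def)
    qed
  qed
  show "(indicator (f -` {c<..} \<inter> space M) :: 'a \<Rightarrow> real) \<in> borel_measurable M" by measurable
  show "(\<lambda>x. 1) \<in> reps M PP H" by (rule const_reps)
  show "\<forall>\<^sub>F t in qs. (indicator (f -` {c<..} \<inter> space M) t :: real) \<le> 1"
    by (intro always_eventually allI) (auto simp: indicator_def)
qed

lemma indicator_vimage_reps:
  assumes f: "f \<in> reps M PP H" and B: "B \<in> sets borel"
  shows "(indicator (f -` B \<inter> space M) :: 'a \<Rightarrow> real) \<in> reps M PP H"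
proof -
  have "B \<in> sigma_sets UNIV (range greaterThan :: real set set)"
    using B by (simp add: borel_Ioi)
  then show ?thesis
  proof induction
    case (Basic B)
    then show ?case using indicator_greater_reps[OF f] by auto
  next
    case Empty
    then show ?case using zero_reps by (simp add: indicator_def[abs_def])
  next
    case (Compl B)
    have "f -` (UNIV - B) \<inter> space M = space M - (f -` B \<inter> space M)" by auto
    then show ?case using indicator_compl_reps[OF Compl.IH] by simp
  next
    case (Union B)
    have "f -` (\<Union>i. B i) \<inter> space M = (\<Union>i. f -` B i \<inter> space M)" by auto
    then show ?case using indicator_UN_reps[OF Union.IH] by simp
  qed
qed

lemma indicator_reps:
  assumes "A \<in> sets M"
  shows "(indicator A :: 'a \<Rightarrow> real) \<in> reps M PP H"
proof -
  have "A \<in> sigma_sets (space M) {f -` B \<inter> space M | f B.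
      f \<in> borel_measurable M \<and> L0_class M PP f \<in> H \<and> B \<in> sets borel}"
    using gen assms by (simp add: generates_def)
  then show ?thesis
  proof induction
    case (Basic A)
    then show ?case using indicator_vimage_reps by (auto simp: reps_def)
  next
    case Empty
    then show ?case using zero_reps by (simp add: indicator_def[abs_def])
  next
    case (Compl A)
    show ?case by (rule indicator_compl_reps[OF Compl.IH])
  next
    case (Union A)
    show ?case by (rule indicator_UN_reps[OF Union.IH])
  qed
qed

text \<open>Each monotone limit needs a majorant from \<open>H\<close>, so the induction carries one
  along. It is kept arbitrary because scaling the function changes the majorant as well.\<close>

lemma nonneg_dominated_reps:
  assumes "f \<in> borel_measurable M" "\<And>x. 0 \<le> f x" "w \<in> reps M PP H" "\<forall>\<^sub>F x in qs. f x \<le> w x"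
  shows "f \<in> reps M PP H"
  using assms
proof (induction f arbitrary: w rule: borel_measurable_induct_real)
  case (set A)
  then show ?case by (intro indicator_reps)
next
  case (mult u c)
  show ?case
  proof (cases "c = 0")
    \<comment> \<open>Here \<open>0 * u\<close> \<le> \<open>w\<close> says nothing about
      \<open>u\<close>, but the product is the constant 0.\<close>
    case True
    then show ?thesis using const_reps[of 0] by simp
  next
    case False
    with mult(1) have c: "0 < c" by simp
    have "u \<in> reps M PP H"
    proof (rule mult.IH)
      show "(\<lambda>x. inverse c * w x) \<in> reps M PP H" using mult.prems(1) by (intro H_scale)
      show "\<forall>\<^sub>F x in qs. u x \<le> inverse c * w x"
        using mult.prems(2) by eventually_elim (use c in \<open>simp add: field_simps\<close>)
    qed
    then show ?thesis by (intro H_scale)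
  qed
next
  case (add u v)
  \<comment> \<open>Both summands are nonnegative, so the majorant of the sum serves each of
    them.\<close>
  have "\<forall>\<^sub>F x in qs. u x \<le> w x" "\<forall>\<^sub>F x in qs. v x \<le> w x"
    by (rule eventually_mono[OF add.prems(2)], use add.hyps(2,4) in \<open>smt (verit)\<close>)+
  then have "u \<in> reps M PP H" "v \<in> reps M PP H"
    using add.IH add.prems(1) by blast+
  then show ?case by (intro H_add)
next
  case (seq U)
  have U_le: "\<forall>\<^sub>F x in qs. U i x \<le> f x" for i
    using qs_space
  proof eventually_elim
    case (elim x)
    have "incseq (\<lambda>i. U i x)" using seq.hyps(3) by (auto simp: incseq_def le_fun_def)
    from incseq_le[OF this seq.hyps(4)[OF elim]] show ?case .
  qed
  show ?case
  proof (rule monotone_limit_reps[OF _ _ seq.prems])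
    show "U i \<in> reps M PP H" for i
    proof (rule seq.IH[OF seq.prems(1)])
      show "\<forall>\<^sub>F x in qs. U i x \<le> w x"
        using U_le[of i] seq.prems(2) by eventually_elim simp
    qed
    show "\<forall>\<^sub>F x in qs. U n x \<le> U (Suc n) x" for n
      using seq.hyps(3) by (intro always_eventually allI) (auto simp: incseq_def le_fun_def)
    show "f \<in> borel_measurable M"
      by (rule borel_measurable_LIMSEQ_real[OF seq.hyps(4) seq.hyps(1)])
    show "\<forall>\<^sub>F x in qs. (\<lambda>n. U n x) \<longlonglongrightarrow> f x"
      by (rule eventually_mono[OF qs_space]) (rule seq.hyps(4))
  qed
qed

lemma ideal: "ideal_in M PP (orlicz_space M PP \<Phi>) H"
  unfolding ideal_in_def
proof (intro conjI ballI impI H_orlicz H_subspace)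
  fix X Y assume X: "X \<in> orlicz_space M PP \<Phi>" and Y: "Y \<in> H"
    and le: "L0_le PP (L0_abs M PP X) (L0_abs M PP Y)"
  define f g where "f = L0_rep X" and "g = L0_rep Y"
  have X0: "X \<in> L0 M PP" using X orlicz_space_subset_L0 by blast
  have [measurable]: "f \<in> borel_measurable M" unfolding f_def by (rule L0_rep(1)[OF X0])
  have g: "g \<in> reps M PP H" unfolding g_def by (rule rep_H[OF Y])
  note [measurable] = repsD(1)[OF g]
  have cl: "X = L0_class M PP f" "Y = L0_class M PP g"
    using L0_rep(2)[OF X0] class_rep_H[OF Y] by (auto simp: f_def g_def)
  \<comment> \<open>The majorant is |g|, written with the lattice and scaling operations under which
    \<open>reps\<close> is known to be closed.\<close>
  have f_le_g: "\<forall>\<^sub>F x in qs. \<bar>f x\<bar> \<le> max (g x) (- 1 * g x)"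
    using le unfolding cl by (auto simp: class_scale_abs le_class elim: eventually_mono)
  have w: "(\<lambda>x. max (g x) (- 1 * g x)) \<in> reps M PP H"
    by (intro max_min_reps H_scale g)
  have "(\<lambda>x. max 0 (f x)) \<in> reps M PP H" "(\<lambda>x. max 0 (- f x)) \<in> reps M PP H"
    by (rule nonneg_dominated_reps[OF _ _ w]; use f_le_g in \<open>auto elim: eventually_mono\<close>)+
  then have "(\<lambda>x. max 0 (f x) - max 0 (- f x)) \<in> reps M PP H" by (rule H_diff)
  also have "(\<lambda>x. max 0 (f x) - max 0 (- f x)) = f" by (auto simp: fun_eq_iff)
  finally show "X \<in> H" by (simp add: cl(1) reps_def)
qed

end

section \<open>Bounded random variables\<close>

lemma (in orlicz_setting) ideal_Linf: "ideal_in M PP (orlicz_space M PP \<Phi>) (Linf M PP)"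
  unfolding ideal_in_def L0_subspace_def
proof (intro conjI ballI allI impI)
  show "Linf M PP \<subseteq> orlicz_space M PP \<Phi>" by (rule Linf_le)
  show "Linf M PP \<subseteq> L0 M PP" by (auto simp: Linf_def L0_class_in_L0)
  have Linf_I: "L0_class M PP f \<in> Linf M PP" if "f \<in> borel_measurable M" "\<And>x. x \<in> space M \<Longrightarrow> \<bar>f x\<bar> \<le> c" for f c
    using that by (auto simp: Linf_def bounded_iff intro!: exI[of _ f])
  show "L0_zero M PP \<in> Linf M PP" unfolding L0_zero_def by (rule Linf_I[of _ 0]) auto
  fix Y assume "Y \<in> Linf M PP"
  then obtain g b where g [measurable]: "g \<in> borel_measurable M" and Y: "Y = L0_class M PP g"
    and b: "\<And>x. x \<in> space M \<Longrightarrow> \<bar>g x\<bar> \<le> b"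
    by (auto simp: Linf_def bounded_iff)
  show "L0_scale M PP c Y \<in> Linf M PP" for c
    unfolding Y class_scale_abs(1)[OF g]
    by (rule Linf_I[of _ "\<bar>c\<bar> * b"]) (auto simp: abs_mult intro: mult_left_mono b)
  show "L0_add M PP Y X \<in> Linf M PP" if X: "X \<in> Linf M PP" for X
  proof -
    obtain f a where f [measurable]: "f \<in> borel_measurable M" and Xf: "X = L0_class M PP f"
      and a: "\<And>x. x \<in> space M \<Longrightarrow> \<bar>f x\<bar> \<le> a"
      using X by (auto simp: Linf_def bounded_iff)
    show ?thesis
      unfolding Xf Y class_arith(1)[OF g f]
    proof (rule Linf_I[of _ "b + a"])
      show "\<bar>g x + f x\<bar> \<le> b + a" if "x \<in> space M" for x using a[OF that] b[OF that] by simp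
    qed measurable
  qed
  show "X \<in> Linf M PP" if X: "X \<in> orlicz_space M PP \<Phi>" "L0_le PP (L0_abs M PP X) (L0_abs M PP Y)" for X
  proof -
    have X0: "X \<in> L0 M PP" using X orlicz_space_subset_L0 by blast
    define f where "f = L0_rep X"
    have f [measurable]: "f \<in> borel_measurable M" unfolding f_def by (rule L0_rep(1)[OF X0])
    have Xf: "X = L0_class M PP f" using L0_rep(2)[OF X0] by (simp add: f_def)
    \<comment> \<open>\<open>Linf\<close> asks for a representative bounded at every point, whereas
      \<open>f\<close> is bounded only quasi-surely; truncation repairs this within the
      class.\<close>
    define h where "h x = (if \<bar>f x\<bar> \<le> \<bar>b\<bar> then f x else 0)" for x
    have h [measurable]: "h \<in> borel_measurable M" unfolding h_def by measurable
    have "\<forall>\<^sub>F x in qs. \<bar>f x\<bar> \<le> \<bar>g x\<bar>"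
      using X(2) by (simp add: Xf Y class_scale_abs le_class)
    then have "\<forall>\<^sub>F x in qs. f x = h x"
      using qs_space
    proof eventually_elim
      case (elim x)
      then show ?case using b[of x] by (simp add: h_def)
    qed
    then have "X = L0_class M PP h" unfolding Xf by (rule L0_class_eqI[OF f h])
    then show ?thesis using Linf_I[of h "\<bar>b\<bar>"] by (simp add: h_def)
  qed
qed

lemma (in orlicz_ideal) Linf_subset:
  assumes "L0_one M PP \<in> H"
  shows "Linf M PP \<subseteq> H"
proof
  fix X assume "X \<in> Linf M PP"
  then obtain f b where f: "f \<in> borel_measurable M" and X: "X = L0_class M PP f"
    and b: "\<And>x. x \<in> space M \<Longrightarrow> \<bar>f x\<bar> \<le> b"
    by (auto simp: Linf_def bounded_iff)
  have one: "indicator (space M) \<in> reps M PP H" using assms by (simp add: reps_def L0_one_def)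
  have "f \<in> reps M PP H"
  proof (rule solid_reps)
    show "(\<lambda>x. b * indicator (space M) x) \<in> reps M PP H" by (rule H_scale[OF one])
    show "\<forall>\<^sub>F x in qs. \<bar>f x\<bar> \<le> \<bar>b * indicator (space M) x\<bar>"
      using qs_space by eventually_elim (use b in force)
  qed (fact f)
  then show "X \<in> H" by (simp add: X reps_def)
qed

text \<open>The inclusion puts every P into \<open>ca_sigma_plus\<close>, which gives one
  domination. The other is part of membership in \<open>ca_of\<close>.\<close>

lemma (in orlicz_subspace) equivalent_of_ca_H:
  assumes "ca_H M PP \<Phi> H \<subseteq> ca_sigma M PP H"
  shows "equivalent M (measure ` PP) (ca_sigma_plus M PP H)"
  unfolding equivalent_def
proof
  have "measure ` PP \<subseteq> ca_sigma_plus M PP H"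
    using assms measure_in_ca_H measure_in_ca_of(3) by (auto simp: ca_sigma_plus_def)
  then have "(SUP \<mu>\<in>measure ` PP. emeasure (tv M \<mu>) N) \<le> (SUP \<mu>\<in>ca_sigma_plus M PP H. emeasure (tv M \<mu>) N)" for N
    by (rule SUP_subset_mono) simp
  then show "dominated M (measure ` PP) (ca_sigma_plus M PP H)"
    unfolding dominated_def by (metis le_zero_eq)
  show "dominated M (ca_sigma_plus M PP H) (measure ` PP)"
    unfolding dominated_def
  proof (intro ballI impI antisym SUP_least)
    fix N \<mu> assume "N \<in> sets M" "(SUP \<nu>\<in>measure ` PP. emeasure (tv M \<nu>) N) = 0" "\<mu> \<in> ca_sigma_plus M PP H"
    then show "emeasure (tv M \<mu>) N \<le> 0"
      by (auto simp: ca_sigma_plus_def ca_sigma_def ca_of_def dominated_def)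
  qed simp
qed

theorem proposition4p9:
  fixes M :: "'a measure" and PP :: "'a measure set"
    and \<Phi> :: "'a measure \<Rightarrow> real \<Rightarrow> ennreal" and H :: "('a \<Rightarrow> real) set set"
  assumes "PP \<noteq> {}"
    and "\<And>P. P \<in> PP \<Longrightarrow> prob_space P \<and> sets P = sets M"
    and "\<And>P. P \<in> PP \<Longrightarrow> orlicz_function (\<Phi> P)"
    and "Linf M PP \<subseteq> orlicz_space M PP \<Phi>"
    and "vector_sublattice_of M PP (orlicz_space M PP \<Phi>) H"
    and "L0_one M PP \<in> H"
    and "generates M PP H"
  shows "((dedekind_sigma_complete (L0_le PP) H \<and>
             equivalent M (measure ` PP) (ca_sigma_plus M PP H))
          \<longleftrightarrow>
          (dedekind_sigma_complete (L0_le PP) H \<and>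
             ca_H M PP \<Phi> H = {\<mu> \<in> ca_sigma M PP H. sint M \<mu> \<in> norm_dual M PP \<Phi> H}))
       \<and> ((dedekind_sigma_complete (L0_le PP) H \<and>
             ca_H M PP \<Phi> H = {\<mu> \<in> ca_sigma M PP H. sint M \<mu> \<in> norm_dual M PP \<Phi> H})
          \<longleftrightarrow>
          ideal_in M PP (orlicz_space M PP \<Phi>) H)
       \<and> (H \<subseteq> Linf M PP \<longrightarrow>
            (ideal_in M PP (orlicz_space M PP \<Phi>) H \<longleftrightarrow> H = Linf M PP))"
    (is "(?D \<and> ?E \<longleftrightarrow> ?D \<and> ?C) \<and> (?D \<and> ?C \<longleftrightarrow> ?I) \<and> (?B \<longrightarrow> (?I \<longleftrightarrow> ?L))")
proof -
  interpret orlicz_subspace M PP \<Phi> H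
    using assms
    by (intro orlicz_subspace.intro orlicz_setting.intro quasi_sure.intro
        orlicz_setting_axioms.intro orlicz_subspace_axioms.intro) (auto simp: vector_sublattice_of_def)
  \<comment> \<open>The cycle is (1) => (3) by \<open>12\<close>, (3) => (2) by \<open>31\<close>,
    and (2) => (1) by \<open>23\<close>. The extra inclusion in \<open>31\<close> gives (3) => (4)
    when \<open>H\<close> lies in \<open>Linf\<close>, and \<open>43\<close> is the
    converse.\<close>
  have 12: "?I" if "?D" "?E"
  proof -
    interpret order_complete_sublattice M PP \<Phi> H
      by unfold_locales (use assms that in \<open>auto simp: vector_sublattice_of_def equivalent_def\<close>)
    show ?thesis by (rule ideal)
  qed
  have 23: "?E" if "?C"
    using that by (intro equivalent_of_ca_H) auto
  have 31: "?D \<and> ?C \<and> Linf M PP \<subseteq> H" if "?I"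
  proof -
    interpret orlicz_ideal M PP \<Phi> H by unfold_locales (rule that)
    show ?thesis using ideal_dedekind_sigma_complete ideal_ca_H Linf_subset[OF assms(6)] by blast
  qed
  have 43: "?I" if "?L"
    unfolding that by (rule ideal_Linf)
  show ?thesis using 12 23 31 43 by blast
qed

end
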